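(* Let $k \geq 1$ be an integer, let $\mathbb{F}_{2^k}$ be the finite field with $2^k$ elements, and let $Q_8=\langle x,y \mid x^4=1,\ x^2=y^2,\ xy=y^{-1}x\rangle$ be the quaternion group of order $8$. Let $V_*(\mathbb{F}_{2^k}Q_8)$ be the group of unitary normalized units of the group algebra $\mathbb{F}_{2^k}Q_8$. Then there is a group isomorphism $$V_*(\mathbb{F}_{2^k}Q_8)\cong C_2^{4k-1}\times Q_8,$$ where $C_2^{4k-1}$ denotes the direct product of $4k-1$ copies of the cyclic group $C_2$ of order $2$.
   Context: For a field $K$ and a finite group $G$, $KG$ denotes the group algebra. The augmentation map $\varepsilon:KG\to K$ is $\varepsilon\left(\sum_{g\in G}a_g g\right)=\sum_{g\in G}a_g$. The normalized unit group $V(KG)$ is the group of all invertible elements of $KG$ with augmentation $1$. The map $*:KG\to KG$ defined by $\left(\sum_{g\in G}a_g g\right)^*=\sum_{g\in G}a_g g^{-1}$ is an antiautomorphism of $KG$. An element $v\in V(KG)$ is called unitary if $v^{-1}=v^*$, and $V_*(KG)$ denotes the subgroup of $V(KG)$ formed by the unitary elements. *)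

theory Defs
  imports "HOL-Algebra.Algebra"
begin

text \<open>
  The group algebra of a finite group \<open>G\<close> over \<open>K\<close>. The element \<open>\<Sum>\<^sub>g a\<^sub>g g\<close> is represented by its
  coefficient function \<open>g \<mapsto> a\<^sub>g\<close>, extensional outside \<open>carrier G\<close>. There is no finite support
  condition, so this is the group algebra for finite \<open>G\<close> only. The coefficient of \<open>g\<close> in a product
  collects the pairs \<open>(h, h\<inverse> g)\<close>, that is, all factorizations of \<open>g\<close>.
\<close>

definition group_algebra ::
    "('k, 'm) ring_scheme \<Rightarrow> ('g, 'n) monoid_scheme \<Rightarrow> ('g \<Rightarrow> 'k) ring" where
  "group_algebra K G =
    \<lparr>carrier = carrier G \<rightarrow>\<^sub>E carrier K,
     monoid.mult = (\<lambda>a b. \<lambda>g\<in>carrier G. \<Oplus>\<^bsub>K\<^esub>h\<in>carrier G. a h \<otimes>\<^bsub>K\<^esub> b (inv\<^bsub>G\<^esub> h \<otimes>\<^bsub>G\<^esub> g)),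
     one = (\<lambda>g\<in>carrier G. if g = \<one>\<^bsub>G\<^esub> then \<one>\<^bsub>K\<^esub> else \<zero>\<^bsub>K\<^esub>),
     ring.zero = (\<lambda>g\<in>carrier G. \<zero>\<^bsub>K\<^esub>),
     add = (\<lambda>a b. \<lambda>g\<in>carrier G. a g \<oplus>\<^bsub>K\<^esub> b g)\<rparr>"

definition augmentation ::
    "('k, 'm) ring_scheme \<Rightarrow> ('g, 'n) monoid_scheme \<Rightarrow> ('g \<Rightarrow> 'k) \<Rightarrow> 'k" where
  "augmentation K G a = (\<Oplus>\<^bsub>K\<^esub>g\<in>carrier G. a g)"

definition normalized_unit_group ::
    "('k, 'm) ring_scheme \<Rightarrow> ('g, 'n) monoid_scheme \<Rightarrow> ('g \<Rightarrow> 'k) monoid" where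
  "normalized_unit_group K G =
    (units_of (group_algebra K G))
      \<lparr>carrier := {v \<in> Units (group_algebra K G). augmentation K G v = \<one>\<^bsub>K\<^esub>}\<rparr>"

text \<open>The coefficient of \<open>g\<close> in \<open>\<Sum>\<^sub>h a\<^sub>h h\<inverse>\<close> is \<open>a\<close> at \<open>g\<inverse>\<close>.\<close>

definition star :: "('g, 'n) monoid_scheme \<Rightarrow> ('g \<Rightarrow> 'k) \<Rightarrow> ('g \<Rightarrow> 'k)" where
  "star G a = (\<lambda>g\<in>carrier G. a (inv\<^bsub>G\<^esub> g))"

definition unitary_unit_group ::
    "('k, 'm) ring_scheme \<Rightarrow> ('g, 'n) monoid_scheme \<Rightarrow> ('g \<Rightarrow> 'k) monoid" where
  "unitary_unit_group K G =
    (normalized_unit_group K G)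
      \<lparr>carrier := {v \<in> carrier (normalized_unit_group K G).
                    inv\<^bsub>normalized_unit_group K G\<^esub> v = star G v}\<rparr>"

text \<open>A letter \<open>(s, True)\<close> stands for the generator \<open>s\<close>, and \<open>(s, False)\<close> for its inverse.\<close>

type_synonym 's word = "('s \<times> bool) list"

text \<open>
  The congruence on words generated by free cancellation and the relations \<open>u = v\<close> for
  \<open>(u, v) \<in> R\<close>. The quotient of the words by it is the group presented by \<open>R\<close>.
\<close>

inductive word_eq :: "('s word \<times> 's word) set \<Rightarrow> 's word \<Rightarrow> 's word \<Rightarrow> bool"
  for R :: "('s word \<times> 's word) set" where
  relation: "(u, v) \<in> R \<Longrightarrow> word_eq R u v"
| cancel: "word_eq R [(s, b), (s, \<not> b)] []"
| refl: "word_eq R u u"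
| sym: "word_eq R u v \<Longrightarrow> word_eq R v u"
| trans: "word_eq R u v \<Longrightarrow> word_eq R v w \<Longrightarrow> word_eq R u w"
| append: "word_eq R u u' \<Longrightarrow> word_eq R v v' \<Longrightarrow> word_eq R (u @ v) (u' @ v')"

definition presented_group :: "('s word \<times> 's word) set \<Rightarrow> 's word set monoid" where
  "presented_group R =
    \<lparr>carrier = UNIV // {(u, v). word_eq R u v},
     monoid.mult = (\<lambda>A B. {w. \<exists>u\<in>A. \<exists>v\<in>B. word_eq R (u @ v) w}),
     one = {w. word_eq R [] w}\<rparr>"

datatype Q8_gen = Gen_x | Gen_y

definition Q8_relations :: "(Q8_gen word \<times> Q8_gen word) set" where
  "Q8_relations =
    {([(Gen_x, True), (Gen_x, True), (Gen_x, True), (Gen_x, True)], []),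
     ([(Gen_x, True), (Gen_x, True)], [(Gen_y, True), (Gen_y, True)]),
     ([(Gen_x, True), (Gen_y, True)], [(Gen_y, False), (Gen_x, True)])}"

definition Q8 :: "Q8_gen word set monoid" where
  "Q8 = presented_group Q8_relations"

end

theory Submission
  imports Defs
begin

text \<open>
  Let \<open>z = x\<^sup>2\<close> be the central involution of \<open>Q = Q\<^sub>8\<close>, and let \<open>I = (1 + z) KQ\<close>, the set of elements whose
  coefficients are constant on the cosets of \<open>{1, z}\<close>. The quotient \<open>Q / {1, z}\<close> is elementary abelian of
  order four and \<open>(1 + z)\<^sup>2 = 0\<close> in characteristic two. Hence members of \<open>I\<close> commute with \<open>Q\<close>,
  are fixed by the star, and multiply to zero. So \<open>1 + I\<close> is a group isomorphic to the additive group of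
  \<open>I\<close>, of order \<open>(2\<^sup>k)\<^sup>4\<close> and exponent two, and every product \<open>(1 + n) g\<close> with \<open>n \<in> I\<close> and \<open>g \<in> Q\<close> is a
  unitary unit (\<open>unit_of_unitary\<close>).

  Conversely there are no other unitary units (\<open>unitary_is_unit_of\<close>). For \<open>v = \<Sum>\<^sub>g v\<^sub>g g\<close>, the coefficients of
  \<open>x\<close>, \<open>y\<close> and \<open>xy\<close> in \<open>v v\<^sup>* = 1\<close> involve \<open>v\<close> only through the sums \<open>v\<^sub>h + v\<^bsub>zh\<^esub>\<close> over cosets, and together with
  the augmentation they force one of these four sums to be one and the others to be zero
  (\<open>char2_unit_vector\<close>). So \<open>v\<close> agrees with some \<open>g \<in> Q\<close> modulo \<open>1 + z\<close>, that is, \<open>v g\<inverse> \<in> 1 + I\<close>.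

  The homomorphism \<open>(n, g) \<mapsto> (1 + n) g\<close> from \<open>I \<times> Q\<close> onto the unitary units has kernel generated by
  \<open>(1 + z, z)\<close>. Replacing \<open>I\<close> by a complement of \<open>{0, 1 + z}\<close> (\<open>complement_of_involution\<close>), which is
  elementary abelian of order \<open>2\<^bsup>4k-1\<^esup>\<close>, makes it an isomorphism.

  The group \<open>Q\<^sub>8\<close> enters through its presentation. That its eight normal forms \<open>z\<^sup>c x\<^sup>a y\<^sup>b\<close> are distinct and
  exhaust it (\<open>quaternion_group_Q8\<close>) is shown by evaluating words in a concrete multiplication of
  exponents.
\<close>

section \<open>Elementary abelian two-groups\<close>

lemma (in group) involutions_commute:
  assumes inv2: "\<And>x. x \<in> carrier G \<Longrightarrow> x \<otimes> x = \<one>"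
    and "x \<in> carrier G" "y \<in> carrier G"
  shows "x \<otimes> y = y \<otimes> x"
proof -
  have "inv w = w" if "w \<in> carrier G" for w
    using inv2[OF that] that by (simp add: inv_equality)
  then show ?thesis
    using assms(2,3) inv_mult_group[of x y] by simp
qed

text \<open>
  A subgroup \<open>B\<close> maximal among those avoiding \<open>a\<close> has index two: for \<open>x \<notin> B\<close> the set \<open>B \<union> xB\<close> is a
  larger subgroup, so by maximality it contains \<open>a\<close>, and \<open>a \<in> xB\<close> means \<open>ax \<in> B\<close>. Hence \<open>B\<close> is a
  complement of \<open>{1, a}\<close>.
\<close>

lemma (in group) complement_of_involution:
  assumes fin: "finite (carrier G)"
    and inv2: "\<And>x. x \<in> carrier G \<Longrightarrow> x \<otimes> x = \<one>"
    and a: "a \<in> carrier G" "a \<noteq> \<one>"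
  obtains B where "subgroup B G" "a \<notin> B"
    "\<And>x. x \<in> carrier G \<Longrightarrow> x \<notin> B \<Longrightarrow> a \<otimes> x \<in> B"
proof -
  let ?S = "{B. subgroup B G \<and> a \<notin> B}"
  have "?S \<subseteq> Pow (carrier G)"
    by (auto dest: subgroup.subset)
  then have "finite ?S"
    using fin finite_subset by blast
  moreover have "{\<one>} \<in> ?S"
    using a triv_subgroup by simp
  ultimately obtain B where B: "B \<in> ?S" and max: "\<And>C. C \<in> ?S \<Longrightarrow> B \<subseteq> C \<Longrightarrow> B = C"
    using finite_has_maximal[of ?S] by blast
  interpret B: subgroup B G
    using B by simp
  have inv_self: "inv w = w" if "w \<in> carrier G" for w
    using inv2[OF that] that by (simp add: inv_equality)
  have comm: "u \<otimes> v = v \<otimes> u" if "u \<in> carrier G" "v \<in> carrier G" for u v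
    using involutions_commute[OF inv2] that by blast
  show ?thesis
  proof (rule that)
    show "subgroup B G" "a \<notin> B"
      using B by auto
    fix x assume x: "x \<in> carrier G" "x \<notin> B"
    have sq: "(x \<otimes> b) \<otimes> (x \<otimes> b') = b \<otimes> b'" if "b \<in> B" "b' \<in> B" for b b'
    proof -
      have c: "b \<in> carrier G" "b' \<in> carrier G"
        using that B.subset by auto
      have "(x \<otimes> b) \<otimes> (x \<otimes> b') = (b \<otimes> x) \<otimes> (x \<otimes> b')"
        using c x comm by simp
      also have "\<dots> = b \<otimes> (x \<otimes> x) \<otimes> b'"
        using c x by (simp add: m_assoc)
      finally show ?thesis
        using c x inv2 by simp
    qed
    have xb: "(x \<otimes> b) \<otimes> b' = x \<otimes> (b \<otimes> b')" "b' \<otimes> (x \<otimes> b) = x \<otimes> (b' \<otimes> b)"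
      if "b \<in> B" "b' \<in> B" for b b'
    proof -
      have c: "b \<in> carrier G" "b' \<in> carrier G"
        using that B.subset by auto
      show "(x \<otimes> b) \<otimes> b' = x \<otimes> (b \<otimes> b')"
        using c x by (simp add: m_assoc)
      then show "b' \<otimes> (x \<otimes> b) = x \<otimes> (b' \<otimes> b)"
        using c x comm[of b' "x \<otimes> b"] comm[of b b'] by simp
    qed
    let ?C = "B \<union> (\<lambda>b. x \<otimes> b) ` B"
    have "subgroup ?C G"
    proof (rule subgroupI)
      show "?C \<subseteq> carrier G"
        using x B.subset by auto
      show "?C \<noteq> {}"
        using B.one_closed by blast
      then show "inv w \<in> ?C" if "w \<in> ?C" for w
        using that \<open>?C \<subseteq> carrier G\<close> inv_self by (metis subsetD)
      show "v \<otimes> w \<in> ?C" if "v \<in> ?C" "w \<in> ?C" for v w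
        using that by (auto simp: sq xb)
    qed
    moreover have "B \<noteq> ?C"
    proof -
      have "x \<in> ?C"
        using x B.one_closed by (metis UnI2 image_eqI r_one)
      then show ?thesis
        using x by blast
    qed
    ultimately have "a \<in> ?C"
      using max[of ?C] by auto
    then obtain b where b: "b \<in> B" "a = x \<otimes> b"
      using B by auto
    then have "a \<otimes> x = b"
      using x sq[of b \<one>] B.one_closed B.mem_carrier by simp
    then show "a \<otimes> x \<in> B"
      using b by simp
  qed
qed

lemma (in group) card_twice_complement:
  assumes fin: "finite (carrier G)"
    and inv2: "\<And>x. x \<in> carrier G \<Longrightarrow> x \<otimes> x = \<one>"
    and a: "a \<in> carrier G"
    and B: "subgroup B G" "a \<notin> B" "\<And>x. x \<in> carrier G \<Longrightarrow> x \<notin> B \<Longrightarrow> a \<otimes> x \<in> B"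
  shows "order G = 2 * card B"
proof -
  interpret B: subgroup B G by (rule B)
  have aa: "a \<otimes> (a \<otimes> w) = w" if "w \<in> carrier G" for w
    using inv2[OF a] a that by (simp add: m_assoc[symmetric])
  have "carrier G = B \<union> (\<lambda>b. a \<otimes> b) ` B"
  proof
    show "carrier G \<subseteq> B \<union> (\<lambda>b. a \<otimes> b) ` B"
    proof
      fix w assume w: "w \<in> carrier G"
      show "w \<in> B \<union> (\<lambda>b. a \<otimes> b) ` B"
        using B(3)[OF w] aa[OF w] by (metis UnI1 UnI2 image_eqI)
    qed
  qed (use a B.subset in auto)
  moreover have "B \<inter> (\<lambda>b. a \<otimes> b) ` B = {}"
  proof -
    have "a \<in> B" if "b \<in> B" "a \<otimes> b \<in> B" for b
    proof -
      have "(a \<otimes> b) \<otimes> inv b = a"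
        using that a B.mem_carrier by (simp add: m_assoc)
      then show ?thesis
        using that B.m_closed B.m_inv_closed by metis
    qed
    then show ?thesis
      using B(2) by auto
  qed
  moreover have "finite B"
    using fin B.subset finite_subset by blast
  moreover have "card ((\<lambda>b. a \<otimes> b) ` B) = card B"
    by (rule card_image) (metis inj_onI aa B.mem_carrier)
  ultimately show ?thesis
    unfolding order_def by (simp add: card_Un_disjoint)
qed

text \<open>
  Induction on \<open>n\<close>: a complement \<open>B\<close> of some \<open>{1, a}\<close> has half the order, and the additional last
  coordinate records whether an element lies in \<open>B\<close> or in \<open>aB\<close>.
\<close>

lemma elementary_abelian_2_group_iso:
  fixes G :: "('a, 'b) monoid_scheme"
  assumes "group G" "order G = 2 ^ n" "\<And>x. x \<in> carrier G \<Longrightarrow> x \<otimes>\<^bsub>G\<^esub> x = \<one>\<^bsub>G\<^esub>"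
  shows "G \<cong> product_group {..<n} (\<lambda>_. integer_mod_group 2)"
  using assms
proof (induction n arbitrary: G)
  case 0
  interpret group G by fact
  from 0 have "carrier G = {\<one>\<^bsub>G\<^esub>}"
    using order_one_triv_iff by (simp add: order_def)
  then have "(\<lambda>x. \<lambda>_. undefined) \<in> iso G (product_group {..<0::nat} (\<lambda>_. integer_mod_group 2))"
    by (auto simp: iso_def hom_def bij_betw_def restrict_def)
  then show ?case
    unfolding is_iso_def by blast
next
  case (Suc n)
  let ?P = "\<lambda>n. product_group {..<n::nat} (\<lambda>_. integer_mod_group 2)"
  interpret G: group G by fact
  note inv2 = Suc.prems(3)
  have fin: "finite (carrier G)"
    using Suc.prems(2) G.order_gt_0_iff_finite by simp
  have "carrier G \<noteq> {\<one>\<^bsub>G\<^esub>}"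
    using Suc.prems(2) by (auto simp: order_def)
  then obtain a where a: "a \<in> carrier G" "a \<noteq> \<one>\<^bsub>G\<^esub>"
    using G.one_closed by blast
  obtain B where B: "subgroup B G" "a \<notin> B"
      "\<And>x. x \<in> carrier G \<Longrightarrow> x \<notin> B \<Longrightarrow> a \<otimes>\<^bsub>G\<^esub> x \<in> B"
    using G.complement_of_involution[OF fin inv2 a] by blast
  interpret B: subgroup B G by (rule B)
  have "card B = 2 ^ n"
    using G.card_twice_complement[OF fin inv2 a(1) B] Suc.prems(2) by simp
  then have "G\<lparr>carrier := B\<rparr> \<cong> ?P n"
    using Suc.IH[of "G\<lparr>carrier := B\<rparr>"] B.subgroup_is_group[OF G.group_axioms] inv2
    by (simp add: order_def)
  then obtain f where f: "f \<in> iso (G\<lparr>carrier := B\<rparr>) (?P n)"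
    unfolding is_iso_def by blast
  have f_bij: "bij_betw f B ({..<n} \<rightarrow>\<^sub>E {0..<2::int})"
    using f by (simp add: iso_def carrier_integer_mod_group)
  have f_mult: "f (u \<otimes>\<^bsub>G\<^esub> v) i = (f u i + f v i) mod 2" if "u \<in> B" "v \<in> B" "i < n" for u v i
    using f that by (simp add: iso_def hom_def)
  have comm: "u \<otimes>\<^bsub>G\<^esub> v = v \<otimes>\<^bsub>G\<^esub> u" if "u \<in> carrier G" "v \<in> carrier G" for u v
    using G.involutions_commute[OF inv2] that by blast
  have aa: "a \<otimes>\<^bsub>G\<^esub> (a \<otimes>\<^bsub>G\<^esub> w) = w" if "w \<in> carrier G" for w
    using inv2[OF a(1)] a(1) that by (simp add: G.m_assoc[symmetric])
  have aB: "a \<otimes>\<^bsub>G\<^esub> w \<notin> B" if "w \<in> B" for w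
  proof
    assume "a \<otimes>\<^bsub>G\<^esub> w \<in> B"
    then have "a \<otimes>\<^bsub>G\<^esub> w \<otimes>\<^bsub>G\<^esub> w \<in> B"
      using that by simp
    then show False
      using B(2) a that inv2 B.mem_carrier by (simp add: G.m_assoc)
  qed
  \<comment> \<open>The projection to \<open>B\<close> along \<open>{1, a}\<close>.\<close>
  define p where "p w = (if w \<in> B then w else a \<otimes>\<^bsub>G\<^esub> w)" for w
  define g where "g = (\<lambda>w. \<lambda>i\<in>{..<Suc n}. if i = n then (if w \<in> B then 0 else 1) else f (p w) i)"
  have pB: "p w \<in> B" if "w \<in> carrier G" for w
    using that B(3) by (simp add: p_def)
  have g_alt: "g w i = (if i = n then (if w \<in> B then 0 else 1) else f (p w) i)" if "i < Suc n" for w i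
    using that by (simp add: g_def)
  have prod_cases: "p (u \<otimes>\<^bsub>G\<^esub> v) = p u \<otimes>\<^bsub>G\<^esub> p v \<and> (u \<otimes>\<^bsub>G\<^esub> v \<in> B \<longleftrightarrow> (u \<in> B \<longleftrightarrow> v \<in> B))"
    if uv: "u \<in> carrier G" "v \<in> carrier G" for u v
  proof -
    have 1: "a \<otimes>\<^bsub>G\<^esub> (u \<otimes>\<^bsub>G\<^esub> v) = (a \<otimes>\<^bsub>G\<^esub> u) \<otimes>\<^bsub>G\<^esub> v"
      using uv a by (simp add: G.m_assoc)
    have 2: "a \<otimes>\<^bsub>G\<^esub> (u \<otimes>\<^bsub>G\<^esub> v) = u \<otimes>\<^bsub>G\<^esub> (a \<otimes>\<^bsub>G\<^esub> v)"
      using uv a comm[of a u] by (simp add: G.m_assoc[symmetric])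
    have 3: "(a \<otimes>\<^bsub>G\<^esub> u) \<otimes>\<^bsub>G\<^esub> (a \<otimes>\<^bsub>G\<^esub> v) = u \<otimes>\<^bsub>G\<^esub> v"
      using uv a 1 2 aa by (metis G.m_assoc G.m_closed)
    have 4: "u \<otimes>\<^bsub>G\<^esub> v \<notin> B" if "a \<otimes>\<^bsub>G\<^esub> (u \<otimes>\<^bsub>G\<^esub> v) \<in> B"
      using aB[OF that] aa uv by auto
    consider "u \<in> B" "v \<in> B" | "u \<in> B" "v \<notin> B" | "u \<notin> B" "v \<in> B" | "u \<notin> B" "v \<notin> B"
      by blast
    then show ?thesis
    proof cases
      case 1
      then show ?thesis by (simp add: p_def)
    next
      case c: 2
      then have "a \<otimes>\<^bsub>G\<^esub> (u \<otimes>\<^bsub>G\<^esub> v) \<in> B"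
        using 2 B(3) uv by simp
      then show ?thesis
        using 2 4 c by (simp add: p_def)
    next
      case c: 3
      then have "a \<otimes>\<^bsub>G\<^esub> (u \<otimes>\<^bsub>G\<^esub> v) \<in> B"
        using 1 B(3) uv by simp
      then show ?thesis
        using 1 4 c by (simp add: p_def)
    next
      case c: 4
      then have "u \<otimes>\<^bsub>G\<^esub> v \<in> B"
        using 3 B(3) uv by (metis B.m_closed)
      then show ?thesis
        using 3 c by (simp add: p_def)
    qed
  qed
  have "g \<in> iso G (?P (Suc n))"
  proof (rule isoI)
    have fr: "f b i \<in> {0..<2}" if "b \<in> B" "i < n" for b i
      using bij_betwE[OF f_bij] that by (auto simp: PiE_iff)
    show "g \<in> hom G (?P (Suc n))"
    proof (rule homI)
      show "g w \<in> carrier (?P (Suc n))" if "w \<in> carrier G" for w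
        using fr[OF pB[OF that]] by (auto simp: g_alt carrier_integer_mod_group PiE_iff less_Suc_eq)
          (auto simp: g_def)
      show "g (u \<otimes>\<^bsub>G\<^esub> v) = g u \<otimes>\<^bsub>?P (Suc n)\<^esub> g v" if uv: "u \<in> carrier G" "v \<in> carrier G" for u v
      proof (rule ext)
        fix i
        show "g (u \<otimes>\<^bsub>G\<^esub> v) i = (g u \<otimes>\<^bsub>?P (Suc n)\<^esub> g v) i"
          using prod_cases[OF uv] f_mult[OF pB[OF uv(1)] pB[OF uv(2)]]
          by (cases "i < Suc n") (auto simp: g_alt less_Suc_eq, auto simp: g_def)
      qed
    qed
    show "bij_betw g (carrier G) (carrier (?P (Suc n)))"
    proof (rule bij_betw_imageI)
      show inj: "inj_on g (carrier G)"
      proof (rule inj_onI)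
        fix u v assume uv: "u \<in> carrier G" "v \<in> carrier G" and eq: "g u = g v"
        have "u \<in> B \<longleftrightarrow> v \<in> B"
          using g_alt[of n u] g_alt[of n v] eq by (auto split: if_splits)
        have "f (p u) i = f (p v) i" for i
        proof (cases "i < n")
          case True
          then show ?thesis
            using g_alt[of i u] g_alt[of i v] eq by simp
        next
          case False
          then show ?thesis
            using bij_betwE[OF f_bij] pB uv by (auto simp: PiE_iff extensional_def)
        qed
        then have "p u = p v"
          using inj_onD[OF bij_betw_imp_inj_on[OF f_bij], of "p u" "p v"] pB uv by blast
        then show "u = v"
          using \<open>u \<in> B \<longleftrightarrow> v \<in> B\<close> uv aa unfolding p_def by (metis (full_types))
      qed
      have "card (carrier (?P (Suc n))) = order G"
        using Suc.prems(2) by (simp add: card_PiE carrier_integer_mod_group)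
      moreover have "g ` carrier G \<subseteq> carrier (?P (Suc n))"
        using \<open>g \<in> hom G (?P (Suc n))\<close> by (auto simp: hom_def)
      ultimately show "g ` carrier G = carrier (?P (Suc n))"
        using inj by (intro card_subset_eq)
          (auto simp: card_image order_def carrier_integer_mod_group intro!: finite_PiE)
    qed
  qed
  then show ?case
    unfolding is_iso_def by blast
qed

section \<open>The presented quaternion group\<close>

text \<open>
  The quotient of the words by \<^const>\<open>word_eq\<close> is handled through its class map, for which equality
  and multiplication have simple rules.
\<close>

definition word_class :: "('s word \<times> 's word) set \<Rightarrow> 's word \<Rightarrow> 's word set" where
  "word_class R u = {v. word_eq R u v}"

lemma word_class_eq_iff: "word_class R u = word_class R v \<longleftrightarrow> word_eq R u v"
  unfolding word_class_def
  by (auto intro: word_eq.refl word_eq.sym word_eq.trans)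

lemma carrier_presented_group: "carrier (presented_group R) = range (word_class R)"
  by (auto simp: presented_group_def quotient_def word_class_def)

lemma one_presented_group: "\<one>\<^bsub>presented_group R\<^esub> = word_class R []"
  by (simp add: presented_group_def word_class_def)

lemma mult_presented_group:
  "word_class R u \<otimes>\<^bsub>presented_group R\<^esub> word_class R v = word_class R (u @ v)"
  unfolding presented_group_def word_class_def
  by (auto intro: word_eq.refl word_eq.trans word_eq.append)

text \<open>
  Read backwards with all exponents flipped, a word cancels against itself from the middle outwards.
\<close>

lemma word_eq_inverse: "word_eq R (rev (map (\<lambda>(s, b). (s, \<not> b)) u) @ u) []"
proof (induction u)
  case Nil
  show ?case
    by (simp add: word_eq.refl)
next
  case (Cons l u)
  obtain s b where l: "l = (s, b)"
    by fastforce
  let ?r = "rev (map (\<lambda>(s, b). (s, \<not> b)) u)"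
  have "word_eq R ([(s, \<not> b), (s, b)] @ u) ([] @ u)"
    using word_eq.cancel[of R s "\<not> b"] by (intro word_eq.append word_eq.refl) simp
  then have "word_eq R (?r @ [(s, \<not> b), (s, b)] @ u) (?r @ u)"
    by (intro word_eq.append word_eq.refl) simp
  then show ?case
    using Cons.IH l by (auto intro: word_eq.trans)
qed

lemma group_presented_group: "group (presented_group R)"
proof (rule groupI)
  show "\<exists>y\<in>carrier (presented_group R). y \<otimes>\<^bsub>presented_group R\<^esub> x = \<one>\<^bsub>presented_group R\<^esub>"
    if "x \<in> carrier (presented_group R)" for x
    using that word_eq_inverse[of R]
    by (force simp: carrier_presented_group one_presented_group mult_presented_group word_class_eq_iff)
qed (auto simp: carrier_presented_group one_presented_group mult_presented_group)

text \<open>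
  The triple \<open>(a, b, c)\<close> stands for \<open>z\<^sup>c x\<^sup>a y\<^sup>b\<close>, where \<open>z = x\<^sup>2\<close>; \<open>True\<close> and \<open>False\<close> are the exponents
  \<open>1\<close> and \<open>0\<close>.
\<close>

type_synonym q8_exponents = "bool \<times> bool \<times> bool"

text \<open>
  In \<open>x\<^sup>a y\<^sup>b x\<^sup>a\<^sup>' y\<^sup>b\<^sup>'\<close> a factor \<open>z\<close> arises from each of \<open>yx = zxy\<close>, \<open>x\<^sup>2 = z\<close>, \<open>y\<^sup>2 = z\<close>. So the exponent
  of \<open>z\<close> changes by \<open>ba' + aa' + bb'\<close> modulo two.
\<close>

fun qmul :: "q8_exponents \<Rightarrow> q8_exponents \<Rightarrow> q8_exponents" where
  "qmul (a, b, c) (a', b', c') =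
     (a \<noteq> a', b \<noteq> b', c \<noteq> (c' \<noteq> ((b \<and> a') \<noteq> ((a \<and> a') \<noteq> (b \<and> b')))))"

lemma qmul_assoc: "qmul (qmul s t) u = qmul s (qmul t u)"
  by (cases s; cases t; cases u) auto

text \<open>
  The relations of \<open>Q\<^sub>8\<close> alone already make the normal forms \<open>z\<^sup>c x\<^sup>a y\<^sup>b\<close> multiply as their exponents do.
  They may still coincide, and they need not exhaust the group; for the presented group this rule is
  what establishes the opposite.
\<close>

locale quaternion_relations = group G for G (structure) +
  fixes x y
  assumes x_closed [simp]: "x \<in> carrier G"
    and y_closed [simp]: "y \<in> carrier G"
    and x_pow_4: "x \<otimes> x \<otimes> x \<otimes> x = \<one>"
    and x_sq_eq_y_sq: "x \<otimes> x = y \<otimes> y"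
    and x_mult_y: "x \<otimes> y = inv y \<otimes> x"
begin

definition z where "z = x \<otimes> x"

definition nf :: "q8_exponents \<Rightarrow> 'a" where
  "nf = (\<lambda>(a, b, c). (if c then z else \<one>) \<otimes> (if a then x else \<one>) \<otimes> (if b then y else \<one>))"

lemma z_closed [simp]: "z \<in> carrier G"
  by (simp add: z_def)

lemma nf_closed [simp]: "nf s \<in> carrier G"
  by (simp add: nf_def split: prod.split)

lemma nf_one: "nf (False, False, False) = \<one>"
  by (simp add: nf_def)

lemma nf_z: "nf (False, False, True) = z"
  by (simp add: nf_def)

text \<open>
  Used from left to right, these equations and their versions under a further factor move \<open>z\<close> to the
  front, then \<open>x\<close> before \<open>y\<close>, and so compute normal forms.
\<close>

lemma normalize:
  "x \<otimes> x = z" "y \<otimes> y = z" "z \<otimes> z = \<one>" "x \<otimes> z = z \<otimes> x" "y \<otimes> z = z \<otimes> y" "y \<otimes> x = z \<otimes> (x \<otimes> y)"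
proof -
  show "x \<otimes> x = z" "x \<otimes> z = z \<otimes> x"
    by (simp_all add: z_def m_assoc)
  show yy: "y \<otimes> y = z" and yz: "y \<otimes> z = z \<otimes> y"
    by (simp_all add: z_def x_sq_eq_y_sq m_assoc)
  show zz: "z \<otimes> z = \<one>"
    using x_pow_4 by (simp add: z_def m_assoc)
  have "y \<otimes> (z \<otimes> y) = \<one>"
    using zz yy yz by (metis m_assoc y_closed z_closed)
  then have "inv y = z \<otimes> y"
    by (metis inv_equality inv_inv inv_closed m_closed y_closed z_closed)
  then have "x \<otimes> y = z \<otimes> (y \<otimes> x)"
    using x_mult_y by (simp add: m_assoc)
  then have "z \<otimes> (x \<otimes> y) = (z \<otimes> z) \<otimes> (y \<otimes> x)"
    by (simp add: m_assoc)
  then show "y \<otimes> x = z \<otimes> (x \<otimes> y)"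
    by (simp add: zz)
qed

lemma normalize_left:
  assumes "w \<in> carrier G"
  shows "x \<otimes> (x \<otimes> w) = z \<otimes> w" "y \<otimes> (y \<otimes> w) = z \<otimes> w" "z \<otimes> (z \<otimes> w) = w"
    "x \<otimes> (z \<otimes> w) = z \<otimes> (x \<otimes> w)" "y \<otimes> (z \<otimes> w) = z \<otimes> (y \<otimes> w)"
    "y \<otimes> (x \<otimes> w) = z \<otimes> (x \<otimes> (y \<otimes> w))"
  using assms normalize by (simp_all add: m_assoc[symmetric])

lemma nf_mult: "nf s \<otimes> nf t = nf (qmul s t)"
  by (cases s; cases t)
    (auto simp: nf_def m_assoc normalize normalize_left)

lemma nf_inv: "inv (nf (a, b, c)) = nf (a, b, c \<noteq> (a \<or> b))"
  by (rule inv_equality) (cases a; cases b; cases c; simp add: nf_mult nf_one)+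

lemma z_mult_nf: "z \<otimes> nf (a, b, c) = nf (a, b, \<not> c)"
  by (simp add: nf_z[symmetric] nf_mult)

end

text \<open>
  This determines the group up to isomorphism, so every later computation in it is a computation with
  exponents.
\<close>

locale quaternion_group = quaternion_relations +
  assumes nf_bij: "bij_betw nf UNIV (carrier G)"

fun letter_value :: "Q8_gen \<times> bool \<Rightarrow> q8_exponents" where
  "letter_value (Gen_x, b) = (True, False, \<not> b)"
| "letter_value (Gen_y, b) = (False, True, \<not> b)"

text \<open>
  Multiplying out a word in the concrete group of exponents gives an invariant of its class. It is
  this invariant that keeps the eight normal forms of the presented group apart.
\<close>

definition word_value :: "Q8_gen word \<Rightarrow> q8_exponents" where
  "word_value u = foldr (\<lambda>l. qmul (letter_value l)) u (False, False, False)"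

lemma word_value_simps [simp]:
  "word_value [] = (False, False, False)"
  "word_value (l # u) = qmul (letter_value l) (word_value u)"
  by (simp_all add: word_value_def)

lemma word_value_append: "word_value (u @ v) = qmul (word_value u) (word_value v)"
  by (induction u) (auto simp: qmul_assoc, cases "word_value v", auto)

lemma word_value_cong: "word_eq Q8_relations u v \<Longrightarrow> word_value u = word_value v"
proof (induction rule: word_eq.induct)
  case (cancel s b)
  then show ?case
    by (cases s) auto
qed (auto simp: Q8_relations_def word_value_append)

definition normal_word :: "q8_exponents \<Rightarrow> Q8_gen word" where
  "normal_word = (\<lambda>(a, b, c). (if c then [(Gen_x, True), (Gen_x, True)] else [])
     @ (if a then [(Gen_x, True)] else []) @ (if b then [(Gen_y, True)] else []))"

lemma word_value_normal_word: "word_value (normal_word s) = s"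
  by (cases s) (auto simp: normal_word_def)

text \<open>
  Every class is a normal form, since the generators and their inverses are normal forms and the
  normal forms are closed under multiplication. Distinct normal forms have distinct word values.
\<close>

lemma quaternion_group_Q8:
  "quaternion_group Q8 (word_class Q8_relations [(Gen_x, True)]) (word_class Q8_relations [(Gen_y, True)])"
proof -
  let ?c = "word_class Q8_relations"
  let ?x = "?c [(Gen_x, True)]" and ?y = "?c [(Gen_y, True)]"
  interpret group Q8
    unfolding Q8_def by (rule group_presented_group)
  have carrier: "carrier Q8 = range ?c" and one: "\<one>\<^bsub>Q8\<^esub> = ?c []"
    and mult: "\<And>u v. ?c u \<otimes>\<^bsub>Q8\<^esub> ?c v = ?c (u @ v)"
    unfolding Q8_def by (simp_all add: carrier_presented_group one_presented_group mult_presented_group)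
  have closed: "?c u \<in> carrier Q8" for u
    by (simp add: carrier)
  have inverse: "inv\<^bsub>Q8\<^esub> ?c [(s, True)] = ?c [(s, False)]" for s
    using word_eq.cancel[of Q8_relations s False]
    by (intro inv_equality) (simp_all add: mult one word_class_eq_iff closed)
  have "?c u = ?c v" if "(u, v) \<in> Q8_relations" for u v
    using that by (simp add: word_class_eq_iff word_eq.relation)
  then have relations:
    "?c [(Gen_x, True), (Gen_x, True), (Gen_x, True), (Gen_x, True)] = ?c []"
    "?c [(Gen_x, True), (Gen_x, True)] = ?c [(Gen_y, True), (Gen_y, True)]"
    "?c [(Gen_x, True), (Gen_y, True)] = ?c [(Gen_y, False), (Gen_x, True)]"
    by (simp_all add: Q8_relations_def)
  interpret quaternion_relations Q8 ?x ?y
  proof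
    show "?x \<in> carrier Q8" "?y \<in> carrier Q8"
      by (rule closed)+
    show "?x \<otimes>\<^bsub>Q8\<^esub> ?x \<otimes>\<^bsub>Q8\<^esub> ?x \<otimes>\<^bsub>Q8\<^esub> ?x = \<one>\<^bsub>Q8\<^esub>"
      by (simp add: mult one relations(1))
    show "?x \<otimes>\<^bsub>Q8\<^esub> ?x = ?y \<otimes>\<^bsub>Q8\<^esub> ?y"
      by (simp add: mult relations(2))
    show "?x \<otimes>\<^bsub>Q8\<^esub> ?y = inv\<^bsub>Q8\<^esub> ?y \<otimes>\<^bsub>Q8\<^esub> ?x"
      by (simp add: inverse mult relations(3))
  qed
  have nf_normal: "nf s = ?c (normal_word s)" for s
    by (cases s) (auto simp: nf_def z_def normal_word_def mult one)
  have letter: "?c [l] = nf (letter_value l)" for l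
  proof (cases l)
    case (Pair s b)
    have "nf (True, False, False) = ?x" "nf (False, True, False) = ?y"
      by (simp_all add: nf_def)
    then show ?thesis
      using Pair inverse[of s] nf_inv[of True False False] nf_inv[of False True False]
      by (cases s; cases b) auto
  qed
  have class_nf: "?c u = nf (word_value u)" for u
  proof (induction u)
    case Nil
    then show ?case
      by (simp add: nf_one one)
  next
    case (Cons l u)
    have "?c (l # u) = ?c [l] \<otimes>\<^bsub>Q8\<^esub> ?c u"
      by (simp add: mult)
    also have "\<dots> = nf (word_value (l # u))"
      unfolding letter[of l] Cons.IH by (simp add: nf_mult)
    finally show ?case .
  qed
  show ?thesis
  proof
    show "bij_betw nf UNIV (carrier Q8)"
    proof (rule bij_betw_imageI)
      show "inj nf"
        by (metis (no_types, lifting) injI nf_normal word_class_eq_iff word_value_cong word_value_normal_word)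
      show "range nf = carrier Q8"
      proof
        show "range nf \<subseteq> carrier Q8"
          by (rule image_subsetI) (rule nf_closed)
        show "carrier Q8 \<subseteq> range nf"
          unfolding carrier
        proof (rule image_subsetI)
          fix u
          show "?c u \<in> range nf"
            unfolding class_nf[of u] by (rule rangeI)
        qed
      qed
    qed
  qed
qed

section \<open>The group algebra of a finite group\<close>

lemma (in abelian_monoid) finsum_swap:
  assumes "finite A" "finite B" "\<And>i j. i \<in> A \<Longrightarrow> j \<in> B \<Longrightarrow> f i j \<in> carrier G"
  shows "(\<Oplus>i\<in>A. \<Oplus>j\<in>B. f i j) = (\<Oplus>j\<in>B. \<Oplus>i\<in>A. f i j)"
  using assms(1,3)
proof (induction A rule: finite_induct)
  case empty
  then show ?case by simp
next
  case (insert i A)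
  have "(\<Oplus>i'\<in>insert i A. \<Oplus>j\<in>B. f i' j) = (\<Oplus>j\<in>B. f i j) \<oplus> (\<Oplus>j\<in>B. \<Oplus>i\<in>A. f i j)"
    using insert by (subst finsum_insert) (auto intro!: finsum_closed)
  also have "\<dots> = (\<Oplus>j\<in>B. f i j \<oplus> (\<Oplus>i\<in>A. f i j))"
    using insert by (intro finsum_addf[symmetric]) (auto intro!: finsum_closed)
  also have "\<dots> = (\<Oplus>j\<in>B. \<Oplus>i'\<in>insert i A. f i' j)"
    using insert by (intro finsum_cong') (auto intro!: finsum_closed)
  finally show ?case .
qed

locale finite_group_algebra = K: cring K + G: group G
  for K :: "('k, 'm) ring_scheme" and G :: "('g, 'n) monoid_scheme" +
  assumes finite_G: "finite (carrier G)"
begin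

abbreviation "KG \<equiv> group_algebra K G"

lemma mem_carrier_iff: "a \<in> carrier KG \<longleftrightarrow> a \<in> carrier G \<rightarrow>\<^sub>E carrier K"
  by (simp add: group_algebra_def)

lemma coeff_closed [simp]: "a \<in> carrier KG \<Longrightarrow> g \<in> carrier G \<Longrightarrow> a g \<in> carrier K"
  by (auto simp: mem_carrier_iff)

lemma element_eqI:
  assumes "a \<in> carrier KG" "b \<in> carrier KG" "\<And>g. g \<in> carrier G \<Longrightarrow> a g = b g"
  shows "a = b"
  using assms by (auto simp: mem_carrier_iff intro: PiE_ext)

lemma coeff_add: "g \<in> carrier G \<Longrightarrow> (a \<oplus>\<^bsub>KG\<^esub> b) g = a g \<oplus>\<^bsub>K\<^esub> b g"
  and coeff_zero: "g \<in> carrier G \<Longrightarrow> \<zero>\<^bsub>KG\<^esub> g = \<zero>\<^bsub>K\<^esub>"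
  and coeff_one: "g \<in> carrier G \<Longrightarrow> \<one>\<^bsub>KG\<^esub> g = (if g = \<one>\<^bsub>G\<^esub> then \<one>\<^bsub>K\<^esub> else \<zero>\<^bsub>K\<^esub>)"
  and coeff_mult: "g \<in> carrier G \<Longrightarrow>
    (a \<otimes>\<^bsub>KG\<^esub> b) g = (\<Oplus>\<^bsub>K\<^esub>h\<in>carrier G. a h \<otimes>\<^bsub>K\<^esub> b (inv\<^bsub>G\<^esub> h \<otimes>\<^bsub>G\<^esub> g))"
  by (simp_all add: group_algebra_def)

lemma sum_closed [simp]: "(\<And>h. h \<in> carrier G \<Longrightarrow> f h \<in> carrier K) \<Longrightarrow> (\<Oplus>\<^bsub>K\<^esub>h\<in>carrier G. f h) \<in> carrier K"
  by (rule K.finsum_closed) auto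

lemma sum_cong:
  assumes "\<And>h. h \<in> carrier G \<Longrightarrow> f h = g h" "\<And>h. h \<in> carrier G \<Longrightarrow> g h \<in> carrier K"
  shows "(\<Oplus>\<^bsub>K\<^esub>h\<in>carrier G. f h) = (\<Oplus>\<^bsub>K\<^esub>h\<in>carrier G. g h)"
  using assms by (intro K.finsum_cong') auto

lemma sum_add:
  assumes "\<And>h. h \<in> carrier G \<Longrightarrow> f h \<in> carrier K" "\<And>h. h \<in> carrier G \<Longrightarrow> g h \<in> carrier K"
  shows "(\<Oplus>\<^bsub>K\<^esub>h\<in>carrier G. f h) \<oplus>\<^bsub>K\<^esub> (\<Oplus>\<^bsub>K\<^esub>h\<in>carrier G. g h) = (\<Oplus>\<^bsub>K\<^esub>h\<in>carrier G. f h \<oplus>\<^bsub>K\<^esub> g h)"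
  using assms by (intro K.finsum_addf[symmetric]) auto

lemma add_closed: "a \<in> carrier KG \<Longrightarrow> b \<in> carrier KG \<Longrightarrow> a \<oplus>\<^bsub>KG\<^esub> b \<in> carrier KG"
  and zero_closed: "\<zero>\<^bsub>KG\<^esub> \<in> carrier KG"
  and one_closed: "\<one>\<^bsub>KG\<^esub> \<in> carrier KG"
  by (auto simp: group_algebra_def PiE_iff)

lemma mult_closed: "a \<in> carrier KG \<Longrightarrow> b \<in> carrier KG \<Longrightarrow> a \<otimes>\<^bsub>KG\<^esub> b \<in> carrier KG"
  unfolding mem_carrier_iff
  by (auto simp: group_algebra_def PiE_iff intro!: K.finsum_closed)

text \<open>
  Translation by a group element permutes the group. This is the change of variables behind
  associativity and behind the multiplicativity of the augmentation.
\<close>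

lemma sum_translate:
  assumes "u \<in> carrier G" "\<And>h. h \<in> carrier G \<Longrightarrow> f h \<in> carrier K"
  shows "(\<Oplus>\<^bsub>K\<^esub>h\<in>carrier G. f (u \<otimes>\<^bsub>G\<^esub> h)) = (\<Oplus>\<^bsub>K\<^esub>h\<in>carrier G. f h)"
proof -
  have "(\<lambda>h. u \<otimes>\<^bsub>G\<^esub> h) ` carrier G = carrier G"
    using assms(1) by (rule G.surj_const_mult)
  moreover have "inj_on (\<lambda>h. u \<otimes>\<^bsub>G\<^esub> h) (carrier G)"
    using assms(1) by (simp add: inj_on_def)
  ultimately show ?thesis
    using K.finsum_reindex[of f "\<lambda>h. u \<otimes>\<^bsub>G\<^esub> h" "carrier G"] assms by auto
qed

lemma sum_single:
  assumes "u \<in> carrier G" "\<And>h. h \<in> carrier G \<Longrightarrow> f h \<in> carrier K"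
    "\<And>h. h \<in> carrier G \<Longrightarrow> h \<noteq> u \<Longrightarrow> f h = \<zero>\<^bsub>K\<^esub>"
  shows "(\<Oplus>\<^bsub>K\<^esub>h\<in>carrier G. f h) = f u"
proof -
  have "(\<Oplus>\<^bsub>K\<^esub>h\<in>carrier G. f h) = (\<Oplus>\<^bsub>K\<^esub>h\<in>carrier G. if u = h then f h else \<zero>\<^bsub>K\<^esub>)"
    using assms by (intro K.finsum_cong') auto
  also have "\<dots> = f u"
    using assms finite_G by (intro K.finsum_singleton) auto
  finally show ?thesis .
qed

lemma mult_assoc:
  assumes abc: "a \<in> carrier KG" "b \<in> carrier KG" "c \<in> carrier KG"
  shows "(a \<otimes>\<^bsub>KG\<^esub> b) \<otimes>\<^bsub>KG\<^esub> c = a \<otimes>\<^bsub>KG\<^esub> (b \<otimes>\<^bsub>KG\<^esub> c)"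
proof (rule element_eqI)
  show "(a \<otimes>\<^bsub>KG\<^esub> b) \<otimes>\<^bsub>KG\<^esub> c \<in> carrier KG" "a \<otimes>\<^bsub>KG\<^esub> (b \<otimes>\<^bsub>KG\<^esub> c) \<in> carrier KG"
    using abc by (simp_all add: mult_closed)
  fix g assume g: "g \<in> carrier G"
  let ?s = "\<lambda>f. \<Oplus>\<^bsub>K\<^esub>h\<in>carrier G. f h"
  let ?i = "\<lambda>h. inv\<^bsub>G\<^esub> h"
  have "((a \<otimes>\<^bsub>KG\<^esub> b) \<otimes>\<^bsub>KG\<^esub> c) g =
      ?s (\<lambda>h. ?s (\<lambda>u. a u \<otimes>\<^bsub>K\<^esub> b (?i u \<otimes>\<^bsub>G\<^esub> h)) \<otimes>\<^bsub>K\<^esub> c (?i h \<otimes>\<^bsub>G\<^esub> g))"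
    using abc g by (simp add: coeff_mult) (intro sum_cong; simp add: coeff_mult)
  also have "\<dots> = ?s (\<lambda>h. ?s (\<lambda>u. a u \<otimes>\<^bsub>K\<^esub> b (?i u \<otimes>\<^bsub>G\<^esub> h) \<otimes>\<^bsub>K\<^esub> c (?i h \<otimes>\<^bsub>G\<^esub> g)))"
    using abc g finite_G by (intro K.finsum_cong' K.finsum_ldistr) auto
  also have "\<dots> = ?s (\<lambda>u. ?s (\<lambda>h. a u \<otimes>\<^bsub>K\<^esub> b (?i u \<otimes>\<^bsub>G\<^esub> h) \<otimes>\<^bsub>K\<^esub> c (?i h \<otimes>\<^bsub>G\<^esub> g)))"
    using abc g finite_G by (intro K.finsum_swap) auto
  also have "\<dots> = ?s (\<lambda>u. a u \<otimes>\<^bsub>K\<^esub> ?s (\<lambda>t. b t \<otimes>\<^bsub>K\<^esub> c (?i t \<otimes>\<^bsub>G\<^esub> (?i u \<otimes>\<^bsub>G\<^esub> g))))"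
  proof (intro K.finsum_cong' refl)
    fix u assume u: "u \<in> carrier G"
    have "?s (\<lambda>h. a u \<otimes>\<^bsub>K\<^esub> b (?i u \<otimes>\<^bsub>G\<^esub> h) \<otimes>\<^bsub>K\<^esub> c (?i h \<otimes>\<^bsub>G\<^esub> g)) =
        ?s (\<lambda>t. a u \<otimes>\<^bsub>K\<^esub> b (?i u \<otimes>\<^bsub>G\<^esub> (u \<otimes>\<^bsub>G\<^esub> t)) \<otimes>\<^bsub>K\<^esub> c (?i (u \<otimes>\<^bsub>G\<^esub> t) \<otimes>\<^bsub>G\<^esub> g))"
      using abc g u by (intro sum_translate[symmetric]) auto
    also have "\<dots> = ?s (\<lambda>t. a u \<otimes>\<^bsub>K\<^esub> (b t \<otimes>\<^bsub>K\<^esub> c (?i t \<otimes>\<^bsub>G\<^esub> (?i u \<otimes>\<^bsub>G\<^esub> g))))"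
      using abc g u
      by (intro K.finsum_cong') (auto simp: G.inv_mult_group G.m_assoc[symmetric] K.m_assoc)
    also have "\<dots> = a u \<otimes>\<^bsub>K\<^esub> ?s (\<lambda>t. b t \<otimes>\<^bsub>K\<^esub> c (?i t \<otimes>\<^bsub>G\<^esub> (?i u \<otimes>\<^bsub>G\<^esub> g)))"
      using abc g u finite_G by (intro K.finsum_rdistr[symmetric]) auto
    finally show "?s (\<lambda>h. a u \<otimes>\<^bsub>K\<^esub> b (?i u \<otimes>\<^bsub>G\<^esub> h) \<otimes>\<^bsub>K\<^esub> c (?i h \<otimes>\<^bsub>G\<^esub> g)) =
        a u \<otimes>\<^bsub>K\<^esub> ?s (\<lambda>t. b t \<otimes>\<^bsub>K\<^esub> c (?i t \<otimes>\<^bsub>G\<^esub> (?i u \<otimes>\<^bsub>G\<^esub> g)))" .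
  qed (use abc g in auto)
  also have "\<dots> = (a \<otimes>\<^bsub>KG\<^esub> (b \<otimes>\<^bsub>KG\<^esub> c)) g"
    using abc g by (simp add: coeff_mult) (intro sum_cong; simp add: coeff_mult)
  finally show "((a \<otimes>\<^bsub>KG\<^esub> b) \<otimes>\<^bsub>KG\<^esub> c) g = (a \<otimes>\<^bsub>KG\<^esub> (b \<otimes>\<^bsub>KG\<^esub> c)) g" .
qed

definition basis :: "'g \<Rightarrow> 'g \<Rightarrow> 'k" where
  "basis u = (\<lambda>g\<in>carrier G. if g = u then \<one>\<^bsub>K\<^esub> else \<zero>\<^bsub>K\<^esub>)"

lemma basis_closed [simp]: "basis u \<in> carrier KG"
  by (auto simp: basis_def mem_carrier_iff)

lemma coeff_basis: "g \<in> carrier G \<Longrightarrow> basis u g = (if g = u then \<one>\<^bsub>K\<^esub> else \<zero>\<^bsub>K\<^esub>)"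
  by (simp add: basis_def)

lemma basis_one: "basis \<one>\<^bsub>G\<^esub> = \<one>\<^bsub>KG\<^esub>"
  by (simp add: basis_def group_algebra_def)

lemma coeff_basis_mult:
  assumes "a \<in> carrier KG" "u \<in> carrier G" "g \<in> carrier G"
  shows "(basis u \<otimes>\<^bsub>KG\<^esub> a) g = a (inv\<^bsub>G\<^esub> u \<otimes>\<^bsub>G\<^esub> g)"
  using assms
  by (simp add: coeff_mult sum_single[of u] coeff_basis)

lemma coeff_mult_basis:
  assumes "a \<in> carrier KG" "u \<in> carrier G" "g \<in> carrier G"
  shows "(a \<otimes>\<^bsub>KG\<^esub> basis u) g = a (g \<otimes>\<^bsub>G\<^esub> inv\<^bsub>G\<^esub> u)"
proof -
  let ?w = "g \<otimes>\<^bsub>G\<^esub> inv\<^bsub>G\<^esub> u"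
  \<comment> \<open>Only the factorization \<open>g = ?w \<otimes> u\<close> of \<open>g\<close> contributes to the coefficient.\<close>
  have factor: "inv\<^bsub>G\<^esub> h \<otimes>\<^bsub>G\<^esub> g = u \<longleftrightarrow> h = ?w" if "h \<in> carrier G" for h
  proof -
    have "inv\<^bsub>G\<^esub> h \<otimes>\<^bsub>G\<^esub> g = u \<longleftrightarrow> g = h \<otimes>\<^bsub>G\<^esub> u"
      using that assms G.inv_solve_left[of u h g] by auto
    also have "\<dots> \<longleftrightarrow> h = ?w"
      using that assms G.inv_solve_right[of h g u] by auto
    finally show ?thesis .
  qed
  have "(a \<otimes>\<^bsub>KG\<^esub> basis u) g = (\<Oplus>\<^bsub>K\<^esub>h\<in>carrier G. if h = ?w then a h else \<zero>\<^bsub>K\<^esub>)"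
    using assms by (simp add: coeff_mult) (intro sum_cong; simp add: coeff_basis factor)
  also have "\<dots> = a ?w"
    using assms by (subst sum_single[of ?w]) auto
  finally show ?thesis .
qed

lemma basis_mult:
  assumes "u \<in> carrier G" "v \<in> carrier G"
  shows "basis u \<otimes>\<^bsub>KG\<^esub> basis v = basis (u \<otimes>\<^bsub>G\<^esub> v)"
proof (rule element_eqI)
  fix g assume g: "g \<in> carrier G"
  have "g \<otimes>\<^bsub>G\<^esub> inv\<^bsub>G\<^esub> v = u \<longleftrightarrow> g = u \<otimes>\<^bsub>G\<^esub> v"
    using G.inv_solve_right[of u g v] assms g by auto
  then show "(basis u \<otimes>\<^bsub>KG\<^esub> basis v) g = basis (u \<otimes>\<^bsub>G\<^esub> v) g"
    using assms g by (simp add: coeff_mult_basis coeff_basis)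
qed (simp_all add: mult_closed)

lemma abelian_group_group_algebra: "abelian_group KG"
proof (rule abelian_groupI)
  show "\<exists>b\<in>carrier KG. b \<oplus>\<^bsub>KG\<^esub> a = \<zero>\<^bsub>KG\<^esub>" if a: "a \<in> carrier KG" for a
  proof
    show b: "(\<lambda>g\<in>carrier G. \<ominus>\<^bsub>K\<^esub> a g) \<in> carrier KG"
      using a by (auto simp: mem_carrier_iff)
    show "(\<lambda>g\<in>carrier G. \<ominus>\<^bsub>K\<^esub> a g) \<oplus>\<^bsub>KG\<^esub> a = \<zero>\<^bsub>KG\<^esub>"
      by (rule element_eqI) (simp_all add: a b add_closed zero_closed coeff_add coeff_zero K.l_neg)
  qed
  fix a b c assume abc: "a \<in> carrier KG" "b \<in> carrier KG" "c \<in> carrier KG"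
  show "a \<oplus>\<^bsub>KG\<^esub> b \<oplus>\<^bsub>KG\<^esub> c = a \<oplus>\<^bsub>KG\<^esub> (b \<oplus>\<^bsub>KG\<^esub> c)"
    by (rule element_eqI) (simp_all add: abc add_closed coeff_add K.a_assoc)
next
  fix a b assume ab: "a \<in> carrier KG" "b \<in> carrier KG"
  show "a \<oplus>\<^bsub>KG\<^esub> b = b \<oplus>\<^bsub>KG\<^esub> a"
    by (rule element_eqI) (simp_all add: ab add_closed coeff_add K.a_comm)
next
  fix a assume a: "a \<in> carrier KG"
  show "\<zero>\<^bsub>KG\<^esub> \<oplus>\<^bsub>KG\<^esub> a = a"
    by (rule element_eqI) (simp_all add: a add_closed zero_closed coeff_add coeff_zero)
qed (simp_all add: add_closed zero_closed)

lemma monoid_group_algebra: "Group.monoid KG"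
proof (rule monoidI)
  fix a assume a: "a \<in> carrier KG"
  show "\<one>\<^bsub>KG\<^esub> \<otimes>\<^bsub>KG\<^esub> a = a"
    by (rule element_eqI) (simp_all add: a basis_one[symmetric] coeff_basis_mult mult_closed)
  show "a \<otimes>\<^bsub>KG\<^esub> \<one>\<^bsub>KG\<^esub> = a"
    by (rule element_eqI) (simp_all add: a basis_one[symmetric] coeff_mult_basis mult_closed)
qed (simp_all add: mult_closed one_closed mult_assoc)

lemma ring_group_algebra: "ring KG"
proof (rule ringI)
  show "abelian_group KG"
    by (rule abelian_group_group_algebra)
  show "Group.monoid KG"
    by (rule monoid_group_algebra)
  fix a b c assume abc: "a \<in> carrier KG" "b \<in> carrier KG" "c \<in> carrier KG"
  show "(a \<oplus>\<^bsub>KG\<^esub> b) \<otimes>\<^bsub>KG\<^esub> c = a \<otimes>\<^bsub>KG\<^esub> c \<oplus>\<^bsub>KG\<^esub> b \<otimes>\<^bsub>KG\<^esub> c"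
  proof (rule element_eqI)
    fix g assume g: "g \<in> carrier G"
    have "((a \<oplus>\<^bsub>KG\<^esub> b) \<otimes>\<^bsub>KG\<^esub> c) g =
        (\<Oplus>\<^bsub>K\<^esub>h\<in>carrier G. a h \<otimes>\<^bsub>K\<^esub> c (inv\<^bsub>G\<^esub> h \<otimes>\<^bsub>G\<^esub> g) \<oplus>\<^bsub>K\<^esub> b h \<otimes>\<^bsub>K\<^esub> c (inv\<^bsub>G\<^esub> h \<otimes>\<^bsub>G\<^esub> g))"
      unfolding coeff_mult[OF g]
      by (rule sum_cong) (simp_all add: abc g coeff_add K.l_distr)
    also have "\<dots> = (a \<otimes>\<^bsub>KG\<^esub> c \<oplus>\<^bsub>KG\<^esub> b \<otimes>\<^bsub>KG\<^esub> c) g"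
      unfolding coeff_add[OF g] coeff_mult[OF g]
      by (rule sum_add[symmetric]) (simp_all add: abc g)
    finally show "((a \<oplus>\<^bsub>KG\<^esub> b) \<otimes>\<^bsub>KG\<^esub> c) g = (a \<otimes>\<^bsub>KG\<^esub> c \<oplus>\<^bsub>KG\<^esub> b \<otimes>\<^bsub>KG\<^esub> c) g" .
  qed (simp_all add: abc add_closed mult_closed)
  show "c \<otimes>\<^bsub>KG\<^esub> (a \<oplus>\<^bsub>KG\<^esub> b) = c \<otimes>\<^bsub>KG\<^esub> a \<oplus>\<^bsub>KG\<^esub> c \<otimes>\<^bsub>KG\<^esub> b"
  proof (rule element_eqI)
    fix g assume g: "g \<in> carrier G"
    have "(c \<otimes>\<^bsub>KG\<^esub> (a \<oplus>\<^bsub>KG\<^esub> b)) g =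
        (\<Oplus>\<^bsub>K\<^esub>h\<in>carrier G. c h \<otimes>\<^bsub>K\<^esub> a (inv\<^bsub>G\<^esub> h \<otimes>\<^bsub>G\<^esub> g) \<oplus>\<^bsub>K\<^esub> c h \<otimes>\<^bsub>K\<^esub> b (inv\<^bsub>G\<^esub> h \<otimes>\<^bsub>G\<^esub> g))"
      unfolding coeff_mult[OF g]
      by (rule sum_cong) (simp_all add: abc g coeff_add K.r_distr)
    also have "\<dots> = (c \<otimes>\<^bsub>KG\<^esub> a \<oplus>\<^bsub>KG\<^esub> c \<otimes>\<^bsub>KG\<^esub> b) g"
      unfolding coeff_add[OF g] coeff_mult[OF g]
      by (rule sum_add[symmetric]) (simp_all add: abc g)
    finally show "(c \<otimes>\<^bsub>KG\<^esub> (a \<oplus>\<^bsub>KG\<^esub> b)) g = (c \<otimes>\<^bsub>KG\<^esub> a \<oplus>\<^bsub>KG\<^esub> c \<otimes>\<^bsub>KG\<^esub> b) g" .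
  qed (simp_all add: abc add_closed mult_closed)
qed

sublocale KG: ring KG
  by (rule ring_group_algebra)

lemma augmentation_closed [simp]: "a \<in> carrier KG \<Longrightarrow> augmentation K G a \<in> carrier K"
  by (simp add: augmentation_def)

lemma augmentation_basis: "u \<in> carrier G \<Longrightarrow> augmentation K G (basis u) = \<one>\<^bsub>K\<^esub>"
  unfolding augmentation_def by (subst sum_single[of u]) (auto simp: coeff_basis)

lemma augmentation_one: "augmentation K G \<one>\<^bsub>KG\<^esub> = \<one>\<^bsub>K\<^esub>"
  using augmentation_basis[of "\<one>\<^bsub>G\<^esub>"] by (simp add: basis_one)

lemma augmentation_add:
  assumes ab: "a \<in> carrier KG" "b \<in> carrier KG"
  shows "augmentation K G (a \<oplus>\<^bsub>KG\<^esub> b) = augmentation K G a \<oplus>\<^bsub>K\<^esub> augmentation K G b"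
proof -
  have "augmentation K G (a \<oplus>\<^bsub>KG\<^esub> b) = (\<Oplus>\<^bsub>K\<^esub>h\<in>carrier G. a h \<oplus>\<^bsub>K\<^esub> b h)"
    unfolding augmentation_def by (rule sum_cong) (simp_all add: ab coeff_add)
  also have "\<dots> = augmentation K G a \<oplus>\<^bsub>K\<^esub> augmentation K G b"
    unfolding augmentation_def by (rule sum_add[symmetric]) (simp_all add: ab)
  finally show ?thesis .
qed

lemma augmentation_mult:
  assumes ab: "a \<in> carrier KG" "b \<in> carrier KG"
  shows "augmentation K G (a \<otimes>\<^bsub>KG\<^esub> b) = augmentation K G a \<otimes>\<^bsub>K\<^esub> augmentation K G b"
proof -
  let ?s = "\<lambda>f. \<Oplus>\<^bsub>K\<^esub>h\<in>carrier G. f h"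
  have "augmentation K G (a \<otimes>\<^bsub>KG\<^esub> b) = ?s (\<lambda>g. ?s (\<lambda>h. a h \<otimes>\<^bsub>K\<^esub> b (inv\<^bsub>G\<^esub> h \<otimes>\<^bsub>G\<^esub> g)))"
    using ab by (simp add: augmentation_def) (intro sum_cong; simp add: coeff_mult)
  also have "\<dots> = ?s (\<lambda>h. ?s (\<lambda>g. a h \<otimes>\<^bsub>K\<^esub> b (inv\<^bsub>G\<^esub> h \<otimes>\<^bsub>G\<^esub> g)))"
    using ab finite_G by (intro K.finsum_swap) auto
  also have "\<dots> = ?s (\<lambda>h. a h \<otimes>\<^bsub>K\<^esub> ?s b)"
  proof (intro K.finsum_cong' refl)
    fix h assume h: "h \<in> carrier G"
    have "?s (\<lambda>g. a h \<otimes>\<^bsub>K\<^esub> b (inv\<^bsub>G\<^esub> h \<otimes>\<^bsub>G\<^esub> g)) = ?s (\<lambda>g. a h \<otimes>\<^bsub>K\<^esub> b g)"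
      using ab h by (intro sum_translate[of "inv\<^bsub>G\<^esub> h" "\<lambda>g. a h \<otimes>\<^bsub>K\<^esub> b g"]) auto
    also have "\<dots> = a h \<otimes>\<^bsub>K\<^esub> ?s b"
      using ab h finite_G by (intro K.finsum_rdistr[symmetric]) auto
    finally show "?s (\<lambda>g. a h \<otimes>\<^bsub>K\<^esub> b (inv\<^bsub>G\<^esub> h \<otimes>\<^bsub>G\<^esub> g)) = a h \<otimes>\<^bsub>K\<^esub> ?s b" .
  qed (use ab in auto)
  also have "\<dots> = ?s a \<otimes>\<^bsub>K\<^esub> ?s b"
    using ab finite_G by (intro K.finsum_ldistr[symmetric]) auto
  finally show ?thesis
    by (simp add: augmentation_def)
qed

lemma star_closed [simp]: "a \<in> carrier KG \<Longrightarrow> star G a \<in> carrier KG"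
  by (auto simp: star_def mem_carrier_iff)

lemma coeff_star: "g \<in> carrier G \<Longrightarrow> star G a g = a (inv\<^bsub>G\<^esub> g)"
  by (simp add: star_def)

lemma inverse_has_augmentation_one:
  assumes "v \<in> carrier KG" "w \<in> carrier KG" "v \<otimes>\<^bsub>KG\<^esub> w = \<one>\<^bsub>KG\<^esub>" "augmentation K G v = \<one>\<^bsub>K\<^esub>"
  shows "augmentation K G w = \<one>\<^bsub>K\<^esub>"
  using augmentation_mult[OF assms(1,2)] assms by (simp add: augmentation_one)

text \<open>
  An inverse in the group algebra of an element of augmentation one again has augmentation one, so it
  is the inverse in the normalized unit group as well.
\<close>

lemma inv_normalized_unit_group:
  assumes vw: "v \<in> carrier KG" "w \<in> carrier KG" "v \<otimes>\<^bsub>KG\<^esub> w = \<one>\<^bsub>KG\<^esub>" "w \<otimes>\<^bsub>KG\<^esub> v = \<one>\<^bsub>KG\<^esub>"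
    and aug: "augmentation K G v = \<one>\<^bsub>K\<^esub>"
  shows "inv\<^bsub>normalized_unit_group K G\<^esub> v = w"
  unfolding m_inv_def
proof (rule the_equality)
  have "augmentation K G w = \<one>\<^bsub>K\<^esub>"
    using inverse_has_augmentation_one vw aug by blast
  then show "w \<in> carrier (normalized_unit_group K G) \<and>
      v \<otimes>\<^bsub>normalized_unit_group K G\<^esub> w = \<one>\<^bsub>normalized_unit_group K G\<^esub> \<and>
      w \<otimes>\<^bsub>normalized_unit_group K G\<^esub> v = \<one>\<^bsub>normalized_unit_group K G\<^esub>"
    using vw by (auto simp: normalized_unit_group_def units_of_def Units_def)
  fix u assume "u \<in> carrier (normalized_unit_group K G) \<and>
      v \<otimes>\<^bsub>normalized_unit_group K G\<^esub> u = \<one>\<^bsub>normalized_unit_group K G\<^esub> \<and>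
      u \<otimes>\<^bsub>normalized_unit_group K G\<^esub> v = \<one>\<^bsub>normalized_unit_group K G\<^esub>"
  then have "u \<in> carrier KG" "u \<otimes>\<^bsub>KG\<^esub> v = \<one>\<^bsub>KG\<^esub>"
    by (auto simp: normalized_unit_group_def units_of_def Units_def)
  then show "u = w"
    using vw KG.inv_unique by blast
qed

text \<open>
  Unitarity as two equations in the group algebra, free of the definite description that defines
  inverses.
\<close>

lemma mem_unitary_unit_group_iff:
  "v \<in> carrier (unitary_unit_group K G) \<longleftrightarrow>
    v \<in> carrier KG \<and> augmentation K G v = \<one>\<^bsub>K\<^esub> \<and>
    v \<otimes>\<^bsub>KG\<^esub> star G v = \<one>\<^bsub>KG\<^esub> \<and> star G v \<otimes>\<^bsub>KG\<^esub> v = \<one>\<^bsub>KG\<^esub>" (is "?L \<longleftrightarrow> ?R")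
proof
  assume L: ?L
  then have v: "v \<in> Units KG" "augmentation K G v = \<one>\<^bsub>K\<^esub>"
      "inv\<^bsub>normalized_unit_group K G\<^esub> v = star G v"
    by (auto simp: unitary_unit_group_def normalized_unit_group_def units_of_def)
  then obtain w where w: "v \<in> carrier KG" "w \<in> carrier KG"
      "v \<otimes>\<^bsub>KG\<^esub> w = \<one>\<^bsub>KG\<^esub>" "w \<otimes>\<^bsub>KG\<^esub> v = \<one>\<^bsub>KG\<^esub>"
    unfolding Units_def by blast
  then have "star G v = w"
    using inv_normalized_unit_group v by metis
  then show ?R
    using v w by simp
next
  assume R: ?R
  then have "inv\<^bsub>normalized_unit_group K G\<^esub> v = star G v"
    by (intro inv_normalized_unit_group) auto
  moreover have "v \<in> Units KG"
    using R star_closed[of v] unfolding Units_def by blast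
  ultimately show ?L
    using R by (auto simp: unitary_unit_group_def normalized_unit_group_def units_of_def)
qed

lemma mult_unitary_unit_group: "v \<otimes>\<^bsub>unitary_unit_group K G\<^esub> w = v \<otimes>\<^bsub>KG\<^esub> w"
  by (simp add: unitary_unit_group_def normalized_unit_group_def units_of_def)

end

section \<open>Unit vectors in characteristic two\<close>

text \<open>
  The additive order annihilates one, and \<open>2\<^sup>n \<cdot> 1 = 0\<close> forces \<open>1 + 1 = 0\<close> because the product
  \<open>2\<^sup>n \<cdot> 1 = (2\<^bsup>n-1\<^esup> \<cdot> 1)(1 + 1)\<close> has a vanishing factor.
\<close>

lemma (in domain) two_eq_zero:
  assumes "order R = 2 ^ n"
  shows "\<one> \<oplus> \<one> = \<zero>"
proof -
  have "[((2::nat) ^ n)] \<cdot> \<one> = \<zero> \<Longrightarrow> \<one> \<oplus> \<one> = \<zero>" for n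
  proof (induction n)
    case 0
    then show ?case by simp
  next
    case (Suc n)
    let ?a = "[((2::nat) ^ n)] \<cdot> \<one>"
    have "[((2::nat) ^ Suc n)] \<cdot> \<one> = ?a \<oplus> ?a"
      using add.nat_pow_mult[of \<one> "2 ^ n" "2 ^ n"] by (simp add: mult_2)
    then have "?a \<otimes> (\<one> \<oplus> \<one>) = \<zero>"
      using Suc.prems by (simp add: r_distr)
    then show ?case
      using integral Suc.IH by auto
  qed
  then show ?thesis
    using add.pow_order_eq_1[of \<one>] assms by (simp add: order_def)
qed

context domain
begin

context
  assumes two_zero: "\<one> \<oplus> \<one> = \<zero>"
begin

lemma char2_add_self:
  assumes "a \<in> carrier R"
  shows "a \<oplus> a = \<zero>"
proof -
  have "a \<oplus> a = a \<otimes> (\<one> \<oplus> \<one>)"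
    using assms by (simp add: r_distr)
  then show ?thesis
    using assms by (simp add: two_zero)
qed

lemma char2_add_eq_zero_iff:
  assumes "a \<in> carrier R" "b \<in> carrier R"
  shows "a \<oplus> b = \<zero> \<longleftrightarrow> a = b"
proof
  assume "a \<oplus> b = \<zero>"
  then have "a \<oplus> b = b \<oplus> b"
    using assms char2_add_self by simp
  then show "a = b"
    using assms by simp
qed (use assms char2_add_self in simp)

lemma char2_triple_equal:
  assumes "t \<in> carrier R" "u \<in> carrier R" "t \<oplus> u = \<one>" "t \<otimes> t \<oplus> t \<otimes> u = \<zero>"
  shows "t = \<zero> \<and> u = \<one>"
proof -
  have "t \<otimes> (t \<oplus> u) = \<zero>"
    using assms(1,2,4) by (simp add: r_distr)
  then have "t = \<zero>"
    using assms by simp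
  then show ?thesis
    using assms by simp
qed

text \<open>
  This is the arithmetic core of the classification: \<open>p, q, r, s\<close> will be the sums of the coefficients
  of a unitary element over four cosets modulo \<open>{1, z}\<close>. Adding two of the relations gives
  \<open>(p + q)(r + s) = 0\<close>, and likewise for the other two ways to split the four elements into pairs.
  Choosing a vanishing factor in each shows that three of the four are equal, to \<open>t\<close> say. With \<open>u\<close>
  the fourth, the sum being one says \<open>t + u = 1\<close>, and any relation says \<open>t(t + u) = 0\<close>, so \<open>t = 0\<close> and \<open>u = 1\<close>.
\<close>

lemma char2_unit_vector:
  assumes closed: "p \<in> carrier R" "q \<in> carrier R" "r \<in> carrier R" "s \<in> carrier R"
    and sum: "p \<oplus> q \<oplus> r \<oplus> s = \<one>"
    and rel: "p \<otimes> q \<oplus> r \<otimes> s = \<zero>" "p \<otimes> r \<oplus> q \<otimes> s = \<zero>" "p \<otimes> s \<oplus> q \<otimes> r = \<zero>"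
  shows "(p, q, r, s) \<in> {(\<one>, \<zero>, \<zero>, \<zero>), (\<zero>, \<one>, \<zero>, \<zero>), (\<zero>, \<zero>, \<one>, \<zero>), (\<zero>, \<zero>, \<zero>, \<one>)}"
proof -
  have pair: "a = b \<or> c = d"
    if "a \<in> carrier R" "b \<in> carrier R" "c \<in> carrier R" "d \<in> carrier R"
      "a \<otimes> c \<oplus> b \<otimes> d = \<zero>" "a \<otimes> d \<oplus> b \<otimes> c = \<zero>" for a b c d
  proof -
    have "(a \<oplus> b) \<otimes> (c \<oplus> d) = (a \<otimes> c \<oplus> b \<otimes> d) \<oplus> (a \<otimes> d \<oplus> b \<otimes> c)"
      using that(1-4) by (simp add: l_distr r_distr a_ac)
    then have "(a \<oplus> b) \<otimes> (c \<oplus> d) = \<zero>"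
      using that by simp
    then have "a \<oplus> b = \<zero> \<or> c \<oplus> d = \<zero>"
      using that(1-4) integral by simp
    then show ?thesis
      using that(1-4) char2_add_eq_zero_iff by simp
  qed
  have cancel: "a \<oplus> (a \<oplus> b) = b" if "a \<in> carrier R" "b \<in> carrier R" for a b
    using that char2_add_self[of a] by (simp add: a_assoc[symmetric])
  have "p = q \<or> r = s"
    using pair[of p q r s] closed rel by (simp add: m_comm a_comm)
  moreover have "p = r \<or> q = s"
    using pair[of p r q s] closed rel by (simp add: m_comm a_comm)
  moreover have "p = s \<or> q = r"
    using pair[of p s q r] closed rel by (simp add: m_comm a_comm)
  ultimately consider "p = q" "q = r" | "p = q" "q = s" | "p = r" "r = s" | "q = r" "r = s"
    by blast
  then show ?thesis
  proof cases
    case 1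
    then have "r = \<zero> \<and> s = \<one>"
      using closed sum rel by (intro char2_triple_equal) (simp_all add: a_assoc cancel)
    then show ?thesis using 1 by simp
  next
    case 2
    then have "s = \<zero> \<and> r = \<one>"
      using closed sum rel
      by (intro char2_triple_equal) (simp_all add: a_assoc m_comm a_lcomm[of r] a_comm[of r] cancel)
    then show ?thesis using 2 by simp
  next
    case 3
    then have "s = \<zero> \<and> q = \<one>"
      using closed sum rel
      by (intro char2_triple_equal) (simp_all add: a_assoc m_comm a_lcomm[of q] a_comm[of q] cancel)
    then show ?thesis using 3 by simp
  next
    case 4
    then have "s = \<zero> \<and> p = \<one>"
      using closed sum rel
      by (intro char2_triple_equal) (simp_all add: a_assoc m_comm[of s p] a_lcomm[of p] a_comm cancel)
    then show ?thesis using 4 by simp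
  qed
qed

end

end

section \<open>The ideal generated by one plus the central involution\<close>

locale quaternion_group_algebra = K: field K + Q: quaternion_group Q x y
  for K :: "('k, 'm) ring_scheme" and Q :: "('g, 'n) monoid_scheme" and x y +
  assumes two_zero: "\<one>\<^bsub>K\<^esub> \<oplus>\<^bsub>K\<^esub> \<one>\<^bsub>K\<^esub> = \<zero>\<^bsub>K\<^esub>"

sublocale quaternion_group_algebra \<subseteq> finite_group_algebra K Q
proof unfold_locales
  show "finite (carrier Q)"
    using Q.nf_bij bij_betw_finite finite_UNIV by blast
qed

context quaternion_group_algebra
begin

lemmas add_self = K.char2_add_self[OF two_zero]
  and add_eq_zero_iff = K.char2_add_eq_zero_iff[OF two_zero]

lemma nf_eq_iff: "Q.nf s = Q.nf t \<longleftrightarrow> s = t"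
  using Q.nf_bij by (metis bij_betw_imp_inj_on inj_eq)

lemma Q_cases:
  assumes "h \<in> carrier Q"
  obtains a b c where "h = Q.nf (a, b, c)"
  using assms Q.nf_bij by (metis bij_betw_imp_surj_on imageE prod_cases3)

lemma sum_cosets:
  assumes f: "\<And>h. h \<in> carrier Q \<Longrightarrow> f h \<in> carrier K"
  shows "(\<Oplus>\<^bsub>K\<^esub>h\<in>carrier Q. f h) =
    (f (Q.nf (False, False, False)) \<oplus>\<^bsub>K\<^esub> f (Q.nf (False, False, True))) \<oplus>\<^bsub>K\<^esub>
    (f (Q.nf (True, False, False)) \<oplus>\<^bsub>K\<^esub> f (Q.nf (True, False, True))) \<oplus>\<^bsub>K\<^esub>
    (f (Q.nf (False, True, False)) \<oplus>\<^bsub>K\<^esub> f (Q.nf (False, True, True))) \<oplus>\<^bsub>K\<^esub>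
    (f (Q.nf (True, True, False)) \<oplus>\<^bsub>K\<^esub> f (Q.nf (True, True, True)))"
proof -
  have U: "(UNIV :: q8_exponents set) = {(False, False, False), (False, False, True),
      (True, False, False), (True, False, True), (False, True, False), (False, True, True),
      (True, True, False), (True, True, True)}"
    by auto
  have "(\<Oplus>\<^bsub>K\<^esub>h\<in>carrier Q. f h) = (\<Oplus>\<^bsub>K\<^esub>s\<in>UNIV. f (Q.nf s))"
    using K.finsum_reindex[of f Q.nf UNIV] Q.nf_bij f
    by (simp add: bij_betw_def Pi_def)
  then show ?thesis
    using f by (simp add: U Pi_def K.a_assoc)
qed

lemma nf_add_z: "Q.z \<otimes>\<^bsub>Q\<^esub> Q.nf (a, b, False) = Q.nf (a, b, True)"
  by (simp add: Q.z_mult_nf)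

text \<open>
  The two elements of each coset of \<open>{1, z}\<close> contribute the same, which cancels in characteristic two.
\<close>

lemma sum_z_invariant:
  assumes f: "\<And>h. h \<in> carrier Q \<Longrightarrow> f h \<in> carrier K"
    and inv: "\<And>h. h \<in> carrier Q \<Longrightarrow> f (Q.z \<otimes>\<^bsub>Q\<^esub> h) = f h"
  shows "(\<Oplus>\<^bsub>K\<^esub>h\<in>carrier Q. f h) = \<zero>\<^bsub>K\<^esub>"
proof -
  have "f (Q.nf (a, b, True)) = f (Q.nf (a, b, False))" for a b
    using inv[of "Q.nf (a, b, False)"] by (simp add: nf_add_z)
  then show ?thesis
    using f by (simp add: sum_cosets add_self)
qed

text \<open>
  The ideal \<open>(1 + z) KQ\<close>, described by coefficients instead of by its generator. It is the kernel of the
  projection to the group algebra of \<open>Q / {1, z}\<close>. Since that quotient is an elementary abelian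
  two-group, the coefficient at a group element is unchanged when that element is inverted or when the
  factors of a product of two group elements are exchanged.
\<close>

definition I :: "('g \<Rightarrow> 'k) set" where
  "I = {n \<in> carrier KG. \<forall>h\<in>carrier Q. n (Q.z \<otimes>\<^bsub>Q\<^esub> h) = n h}"

lemma I_closed: "n \<in> I \<Longrightarrow> n \<in> carrier KG"
  by (simp add: I_def)

lemma I_coeff:
  assumes "n \<in> I"
  shows "n (Q.nf (a, b, c)) = n (Q.nf (a, b, d))"
proof -
  have "n (Q.z \<otimes>\<^bsub>Q\<^esub> Q.nf (a, b, False)) = n (Q.nf (a, b, False))"
    using assms by (simp add: I_def)
  then show ?thesis
    by (cases c; cases d) (simp_all add: nf_add_z)
qed

lemma I_coeff_comm:
  assumes "n \<in> I" "g \<in> carrier Q" "h \<in> carrier Q"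
  shows "n (g \<otimes>\<^bsub>Q\<^esub> h) = n (h \<otimes>\<^bsub>Q\<^esub> g)"
proof -
  obtain a b c where g: "g = Q.nf (a, b, c)"
    using assms(2) by (rule Q_cases)
  obtain a' b' c' where h: "h = Q.nf (a', b', c')"
    using assms(3) by (rule Q_cases)
  have *: "(a' \<noteq> a) = (a \<noteq> a')" "(b' \<noteq> b) = (b \<noteq> b')"
    by auto
  show ?thesis
    unfolding g h Q.nf_mult qmul.simps * by (rule I_coeff[OF assms(1)])
qed

lemma I_coeff_inv:
  assumes "n \<in> I" "g \<in> carrier Q"
  shows "n (inv\<^bsub>Q\<^esub> g) = n g"
proof -
  obtain a b c where g: "g = Q.nf (a, b, c)"
    using assms(2) by (rule Q_cases)
  show ?thesis
    unfolding g Q.nf_inv by (rule I_coeff[OF assms(1)])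
qed

lemma KG_add_self:
  assumes "a \<in> carrier KG"
  shows "a \<oplus>\<^bsub>KG\<^esub> a = \<zero>\<^bsub>KG\<^esub>"
  by (rule element_eqI) (simp_all add: assms add_closed zero_closed coeff_add coeff_zero add_self)

lemma I_add: "n \<in> I \<Longrightarrow> m \<in> I \<Longrightarrow> n \<oplus>\<^bsub>KG\<^esub> m \<in> I"
  by (simp add: I_def coeff_add)

lemma I_zero: "\<zero>\<^bsub>KG\<^esub> \<in> I"
  by (simp add: I_def coeff_zero zero_closed)

text \<open>
  The generator \<open>1 + z\<close> of the ideal has square \<open>1 + z\<^sup>2 = 0\<close>. On coefficients, every sum that defines a
  product is invariant under \<open>h \<mapsto> zh\<close>.
\<close>

lemma I_mult_zero:
  assumes "n \<in> I" "m \<in> I"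
  shows "n \<otimes>\<^bsub>KG\<^esub> m = \<zero>\<^bsub>KG\<^esub>"
proof (rule element_eqI)
  note closed = assms[THEN I_closed]
  show "n \<otimes>\<^bsub>KG\<^esub> m \<in> carrier KG" "\<zero>\<^bsub>KG\<^esub> \<in> carrier KG"
    using closed by (simp_all add: mult_closed)
  fix g assume g: "g \<in> carrier Q"
  have "(\<Oplus>\<^bsub>K\<^esub>h\<in>carrier Q. n h \<otimes>\<^bsub>K\<^esub> m (inv\<^bsub>Q\<^esub> h \<otimes>\<^bsub>Q\<^esub> g)) = \<zero>\<^bsub>K\<^esub>"
  proof (rule sum_z_invariant)
    fix h assume h: "h \<in> carrier Q"
    have "m (inv\<^bsub>Q\<^esub> (Q.z \<otimes>\<^bsub>Q\<^esub> h) \<otimes>\<^bsub>Q\<^esub> g) = m (inv\<^bsub>Q\<^esub> h \<otimes>\<^bsub>Q\<^esub> (inv\<^bsub>Q\<^esub> Q.z \<otimes>\<^bsub>Q\<^esub> g))"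
      using g h by (simp add: Q.inv_mult_group Q.m_assoc)
    also have "\<dots> = m (Q.z \<otimes>\<^bsub>Q\<^esub> (g \<otimes>\<^bsub>Q\<^esub> inv\<^bsub>Q\<^esub> h))"
      using I_coeff_comm[OF assms(2), of "inv\<^bsub>Q\<^esub> h" "Q.z \<otimes>\<^bsub>Q\<^esub> g"] g h Q.inv_equality[OF Q.normalize(3)]
      by (simp add: Q.m_assoc)
    also have "\<dots> = m (inv\<^bsub>Q\<^esub> h \<otimes>\<^bsub>Q\<^esub> g)"
      using assms(2) I_coeff_comm[OF assms(2), of "inv\<^bsub>Q\<^esub> h" g] g h by (simp add: I_def)
    finally show "n (Q.z \<otimes>\<^bsub>Q\<^esub> h) \<otimes>\<^bsub>K\<^esub> m (inv\<^bsub>Q\<^esub> (Q.z \<otimes>\<^bsub>Q\<^esub> h) \<otimes>\<^bsub>Q\<^esub> g) =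
        n h \<otimes>\<^bsub>K\<^esub> m (inv\<^bsub>Q\<^esub> h \<otimes>\<^bsub>Q\<^esub> g)"
      using assms(1) h by (simp add: I_def)
  qed (use closed g in simp)
  then show "(n \<otimes>\<^bsub>KG\<^esub> m) g = \<zero>\<^bsub>KG\<^esub> g"
    using g by (simp add: coeff_mult coeff_zero)
qed

lemma I_basis_comm:
  assumes "n \<in> I" "g \<in> carrier Q"
  shows "basis g \<otimes>\<^bsub>KG\<^esub> n = n \<otimes>\<^bsub>KG\<^esub> basis g"
  using assms I_closed[OF assms(1)]
  by (intro element_eqI) (simp_all add: mult_closed coeff_basis_mult coeff_mult_basis I_coeff_comm)

lemma augmentation_I: "n \<in> I \<Longrightarrow> augmentation K Q n = \<zero>\<^bsub>K\<^esub>"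
  unfolding augmentation_def by (rule sum_z_invariant) (auto simp: I_def)

text \<open>
  For \<open>n\<close> in the ideal these elements \<open>(1 + n) g\<close> turn out to be exactly the unitary units.
\<close>

definition unit_of :: "('g \<Rightarrow> 'k) \<Rightarrow> 'g \<Rightarrow> 'g \<Rightarrow> 'k" where
  "unit_of n g = (\<one>\<^bsub>KG\<^esub> \<oplus>\<^bsub>KG\<^esub> n) \<otimes>\<^bsub>KG\<^esub> basis g"

lemma unit_of_closed: "n \<in> I \<Longrightarrow> unit_of n g \<in> carrier KG"
  by (simp add: unit_of_def mult_closed add_closed one_closed I_closed)

lemma coeff_unit_of:
  assumes "n \<in> I" "g \<in> carrier Q" "h \<in> carrier Q"
  shows "unit_of n g h = (if h = g then \<one>\<^bsub>K\<^esub> else \<zero>\<^bsub>K\<^esub>) \<oplus>\<^bsub>K\<^esub> n (h \<otimes>\<^bsub>Q\<^esub> inv\<^bsub>Q\<^esub> g)"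
proof -
  have "h \<otimes>\<^bsub>Q\<^esub> inv\<^bsub>Q\<^esub> g = \<one>\<^bsub>Q\<^esub> \<longleftrightarrow> h = g"
    using Q.inv_solve_right[of "\<one>\<^bsub>Q\<^esub>" h g] assms by auto
  then show ?thesis
    using assms by (simp add: unit_of_def coeff_mult_basis coeff_add coeff_one add_closed one_closed I_closed)
qed

lemma one_plus_I_mult:
  assumes "n \<in> I" "m \<in> I"
  shows "(\<one>\<^bsub>KG\<^esub> \<oplus>\<^bsub>KG\<^esub> n) \<otimes>\<^bsub>KG\<^esub> (\<one>\<^bsub>KG\<^esub> \<oplus>\<^bsub>KG\<^esub> m) = \<one>\<^bsub>KG\<^esub> \<oplus>\<^bsub>KG\<^esub> (n \<oplus>\<^bsub>KG\<^esub> m)"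
  using assms[THEN I_closed] I_mult_zero[OF assms]
  by (simp add: KG.l_distr KG.r_distr KG.a_ac)

text \<open>
  The factors \<open>1 + n\<close> commute with the group elements, and \<open>nm = 0\<close> turns the product of \<open>1 + n\<close> and \<open>1 + m\<close>
  into a sum.
\<close>

lemma unit_of_mult:
  assumes n: "n \<in> I" "m \<in> I" and g: "g \<in> carrier Q" "h \<in> carrier Q"
  shows "unit_of n g \<otimes>\<^bsub>KG\<^esub> unit_of m h = unit_of (n \<oplus>\<^bsub>KG\<^esub> m) (g \<otimes>\<^bsub>Q\<^esub> h)"
proof -
  let ?n = "\<one>\<^bsub>KG\<^esub> \<oplus>\<^bsub>KG\<^esub> n" and ?m = "\<one>\<^bsub>KG\<^esub> \<oplus>\<^bsub>KG\<^esub> m"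
  have closed: "?n \<in> carrier KG" "?m \<in> carrier KG" "m \<in> carrier KG"
    using n by (auto intro: I_closed)
  have "basis g \<otimes>\<^bsub>KG\<^esub> ?m = ?m \<otimes>\<^bsub>KG\<^esub> basis g"
    using closed by (simp add: KG.l_distr KG.r_distr I_basis_comm[OF n(2) g(1)])
  have "unit_of n g \<otimes>\<^bsub>KG\<^esub> unit_of m h = ?n \<otimes>\<^bsub>KG\<^esub> (basis g \<otimes>\<^bsub>KG\<^esub> ?m) \<otimes>\<^bsub>KG\<^esub> basis h"
    using closed by (simp add: unit_of_def KG.m_assoc)
  also have "\<dots> = (?n \<otimes>\<^bsub>KG\<^esub> ?m) \<otimes>\<^bsub>KG\<^esub> (basis g \<otimes>\<^bsub>KG\<^esub> basis h)"
    using closed \<open>basis g \<otimes>\<^bsub>KG\<^esub> ?m = _\<close> by (simp add: KG.m_assoc)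
  also have "\<dots> = unit_of (n \<oplus>\<^bsub>KG\<^esub> m) (g \<otimes>\<^bsub>Q\<^esub> h)"
    using one_plus_I_mult[OF n] basis_mult[OF g] by (simp add: unit_of_def)
  finally show ?thesis .
qed

lemma unit_of_zero_one: "unit_of \<zero>\<^bsub>KG\<^esub> \<one>\<^bsub>Q\<^esub> = \<one>\<^bsub>KG\<^esub>"
  by (simp add: unit_of_def basis_one)

lemma star_unit_of:
  assumes n: "n \<in> I" and g: "g \<in> carrier Q"
  shows "star Q (unit_of n g) = unit_of n (inv\<^bsub>Q\<^esub> g)"
proof (rule element_eqI)
  show "star Q (unit_of n g) \<in> carrier KG" "unit_of n (inv\<^bsub>Q\<^esub> g) \<in> carrier KG"
    using n by (simp_all add: unit_of_closed)
  fix h assume h: "h \<in> carrier Q"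
  have "inv\<^bsub>Q\<^esub> h = g \<longleftrightarrow> h = inv\<^bsub>Q\<^esub> g"
    using g h by auto
  moreover have "n (inv\<^bsub>Q\<^esub> h \<otimes>\<^bsub>Q\<^esub> inv\<^bsub>Q\<^esub> g) = n (h \<otimes>\<^bsub>Q\<^esub> g)"
    using I_coeff_inv[OF n, of "g \<otimes>\<^bsub>Q\<^esub> h"] I_coeff_comm[OF n g h] g h
    by (simp add: Q.inv_mult_group)
  ultimately show "star Q (unit_of n g) h = unit_of n (inv\<^bsub>Q\<^esub> g) h"
    using n g h by (simp add: coeff_star coeff_unit_of)
qed

text \<open>
  The inverse of \<open>(1 + n) g\<close> is \<open>(1 + n) g\<inverse>\<close>, and this is also its image under the star, because \<open>n\<close> does not
  change when the group is inverted.
\<close>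

lemma unit_of_unitary:
  assumes n: "n \<in> I" and g: "g \<in> carrier Q"
  shows "unit_of n g \<in> carrier (unitary_unit_group K Q)"
proof -
  have "augmentation K Q (unit_of n g) = \<one>\<^bsub>K\<^esub>"
    using n g by (simp add: unit_of_def augmentation_mult augmentation_add augmentation_one
        augmentation_I augmentation_basis I_closed)
  then show ?thesis
    using n g by (simp add: mem_unitary_unit_group_iff star_unit_of unit_of_closed unit_of_mult
        KG_add_self I_closed unit_of_zero_one)
qed

text \<open>
  The element \<open>1 + z\<close> of the ideal. It measures how far the representation \<open>(1 + n) g\<close> is from being
  unique: \<open>(1 + (1 + z)) z = z\<^sup>2 = 1\<close>.
\<close>

definition z_offset :: "'g \<Rightarrow> 'k" where
  "z_offset = \<one>\<^bsub>KG\<^esub> \<oplus>\<^bsub>KG\<^esub> basis Q.z"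

lemma z_neq_one: "Q.z \<noteq> \<one>\<^bsub>Q\<^esub>"
  using nf_eq_iff[of "(False, False, True)" "(False, False, False)"] by (simp add: Q.nf_z Q.nf_one)

lemma z_mult_eq_iff:
  assumes "h \<in> carrier Q"
  shows "Q.z \<otimes>\<^bsub>Q\<^esub> h = Q.z \<longleftrightarrow> h = \<one>\<^bsub>Q\<^esub>" "Q.z \<otimes>\<^bsub>Q\<^esub> h = \<one>\<^bsub>Q\<^esub> \<longleftrightarrow> h = Q.z"
  using assms Q.normalize(3) Q.normalize_left(3) by (metis Q.r_one Q.z_closed)+

lemma z_offset_in_I: "z_offset \<in> I"
  unfolding I_def z_offset_def
  by (auto simp: coeff_add coeff_one coeff_basis z_mult_eq_iff z_neq_one z_neq_one[symmetric])

lemma z_offset_nonzero: "z_offset \<noteq> \<zero>\<^bsub>KG\<^esub>"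
proof
  assume "z_offset = \<zero>\<^bsub>KG\<^esub>"
  then have "z_offset \<one>\<^bsub>Q\<^esub> = \<zero>\<^bsub>K\<^esub>"
    by (simp add: coeff_zero)
  then show False
    by (simp add: z_offset_def coeff_add coeff_one coeff_basis z_neq_one[symmetric])
qed

lemma unit_of_z_offset: "unit_of z_offset Q.z = \<one>\<^bsub>KG\<^esub>"
proof -
  have "\<one>\<^bsub>KG\<^esub> \<oplus>\<^bsub>KG\<^esub> z_offset = basis Q.z"
    by (simp add: z_offset_def KG.a_assoc[symmetric] KG_add_self)
  then show ?thesis
    by (simp add: unit_of_def basis_mult Q.normalize(3) basis_one)
qed

lemma unit_of_eq_one:
  assumes n: "n \<in> I" and k: "k \<in> carrier Q" and eq: "unit_of n k = \<one>\<^bsub>KG\<^esub>"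
  shows "n = \<zero>\<^bsub>KG\<^esub> \<and> k = \<one>\<^bsub>Q\<^esub> \<or> n = z_offset \<and> k = Q.z"
proof -
  have "k \<in> {\<one>\<^bsub>Q\<^esub>, Q.z}"
  proof (rule ccontr)
    assume "k \<notin> {\<one>\<^bsub>Q\<^esub>, Q.z}"
    then have *: "Q.z \<otimes>\<^bsub>Q\<^esub> k \<noteq> \<one>\<^bsub>Q\<^esub>" "k \<noteq> \<one>\<^bsub>Q\<^esub>" "Q.z \<otimes>\<^bsub>Q\<^esub> k \<noteq> k"
      using k z_mult_eq_iff(2) z_neq_one by auto
    have "n (Q.z \<otimes>\<^bsub>Q\<^esub> \<one>\<^bsub>Q\<^esub>) = n \<one>\<^bsub>Q\<^esub>"
      using n Q.one_closed unfolding I_def by blast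
    then have nz: "n Q.z = n \<one>\<^bsub>Q\<^esub>"
      by simp
    \<comment> \<open>Compare the coefficients of \<open>k\<close> and of \<open>zk\<close>, neither of which is the identity.\<close>
    have "\<one>\<^bsub>K\<^esub> \<oplus>\<^bsub>K\<^esub> n \<one>\<^bsub>Q\<^esub> = \<zero>\<^bsub>K\<^esub>"
      using coeff_unit_of[OF n k k] eq * k I_closed[OF n] by (simp add: coeff_one)
    moreover have "n \<one>\<^bsub>Q\<^esub> = \<zero>\<^bsub>K\<^esub>"
      using coeff_unit_of[OF n k, of "Q.z \<otimes>\<^bsub>Q\<^esub> k"] eq * k I_closed[OF n] nz
      by (simp add: coeff_one Q.m_assoc)
    ultimately show False
      by simp
  qed
  moreover have "n = \<zero>\<^bsub>KG\<^esub>" if "k = \<one>\<^bsub>Q\<^esub>"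
    using eq that I_closed[OF n] by (simp add: unit_of_def basis_one)
  moreover have "n = z_offset" if "k = Q.z"
  proof -
    have "unit_of n Q.z \<otimes>\<^bsub>KG\<^esub> unit_of z_offset Q.z = \<one>\<^bsub>KG\<^esub>"
      using eq that unit_of_z_offset by simp
    then have "unit_of (n \<oplus>\<^bsub>KG\<^esub> z_offset) \<one>\<^bsub>Q\<^esub> = \<one>\<^bsub>KG\<^esub>"
      using n z_offset_in_I by (simp add: unit_of_mult Q.normalize(3))
    then have "n \<oplus>\<^bsub>KG\<^esub> z_offset = \<zero>\<^bsub>KG\<^esub>"
      using I_closed[OF n] I_closed[OF z_offset_in_I] by (simp add: unit_of_def basis_one)
    then have "n \<oplus>\<^bsub>KG\<^esub> z_offset = z_offset \<oplus>\<^bsub>KG\<^esub> z_offset"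
      using I_closed[OF z_offset_in_I] by (simp add: KG_add_self)
    then show ?thesis
      using I_closed[OF n] I_closed[OF z_offset_in_I] by simp
  qed
  ultimately show ?thesis
    by auto
qed

section \<open>Unitary units are group elements modulo the ideal\<close>

definition coset_sum :: "('g \<Rightarrow> 'k) \<Rightarrow> bool \<Rightarrow> bool \<Rightarrow> 'k" where
  "coset_sum v a b = v (Q.nf (a, b, False)) \<oplus>\<^bsub>K\<^esub> v (Q.nf (a, b, True))"

lemma coset_sum_closed: "v \<in> carrier KG \<Longrightarrow> coset_sum v a b \<in> carrier K"
  by (simp add: coset_sum_def)

lemma coeff_mult_star:
  assumes v: "v \<in> carrier KG" and g: "g \<in> carrier Q"
  shows "(v \<otimes>\<^bsub>KG\<^esub> star Q v) g = (\<Oplus>\<^bsub>K\<^esub>h\<in>carrier Q. v h \<otimes>\<^bsub>K\<^esub> v (inv\<^bsub>Q\<^esub> g \<otimes>\<^bsub>Q\<^esub> h))"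
  unfolding coeff_mult[OF g]
  by (rule sum_cong) (simp_all add: v g coeff_star Q.inv_mult_group)

text \<open>
  These are the coefficients of \<open>x\<close>, \<open>y\<close> and \<open>xy\<close> in \<open>v v\<^sup>* = 1\<close>. In each the eight terms combine to products
  of sums over cosets of \<open>{1, z}\<close>, because \<open>g\<close> and \<open>g\<inverse> = zg\<close> lie in the same coset.
\<close>

lemma unitary_coset_relations:
  assumes v: "v \<in> carrier KG" and vv: "v \<otimes>\<^bsub>KG\<^esub> star Q v = \<one>\<^bsub>KG\<^esub>"
  defines "c \<equiv> coset_sum v"
  shows "c False False \<otimes>\<^bsub>K\<^esub> c True False \<oplus>\<^bsub>K\<^esub> c False True \<otimes>\<^bsub>K\<^esub> c True True = \<zero>\<^bsub>K\<^esub>"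
    and "c False False \<otimes>\<^bsub>K\<^esub> c False True \<oplus>\<^bsub>K\<^esub> c True False \<otimes>\<^bsub>K\<^esub> c True True = \<zero>\<^bsub>K\<^esub>"
    and "c False False \<otimes>\<^bsub>K\<^esub> c True True \<oplus>\<^bsub>K\<^esub> c True False \<otimes>\<^bsub>K\<^esub> c False True = \<zero>\<^bsub>K\<^esub>"
proof -
  have vanish: "(\<Oplus>\<^bsub>K\<^esub>h\<in>carrier Q. v h \<otimes>\<^bsub>K\<^esub> v (inv\<^bsub>Q\<^esub> Q.nf (a, b, False) \<otimes>\<^bsub>Q\<^esub> h)) = \<zero>\<^bsub>K\<^esub>"
    if "a \<or> b" for a b
  proof -
    have "Q.nf (a, b, False) \<noteq> \<one>\<^bsub>Q\<^esub>"
      unfolding Q.nf_one[symmetric] nf_eq_iff using that by auto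
    then show ?thesis
      using coeff_mult_star[OF v, of "Q.nf (a, b, False)"] by (simp add: vv coeff_one)
  qed
  have vc: "v (Q.nf s) \<in> carrier K" for s
    using v by simp
  show "c False False \<otimes>\<^bsub>K\<^esub> c True False \<oplus>\<^bsub>K\<^esub> c False True \<otimes>\<^bsub>K\<^esub> c True True = \<zero>\<^bsub>K\<^esub>"
    using vanish[of True False]
    by (simp add: sum_cosets v Q.nf_inv Q.nf_mult c_def coset_sum_def vc K.l_distr K.r_distr K.m_comm K.a_ac)
  show "c False False \<otimes>\<^bsub>K\<^esub> c False True \<oplus>\<^bsub>K\<^esub> c True False \<otimes>\<^bsub>K\<^esub> c True True = \<zero>\<^bsub>K\<^esub>"
    using vanish[of False True]
    by (simp add: sum_cosets v Q.nf_inv Q.nf_mult c_def coset_sum_def vc K.l_distr K.r_distr K.m_comm K.a_ac)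
  show "c False False \<otimes>\<^bsub>K\<^esub> c True True \<oplus>\<^bsub>K\<^esub> c True False \<otimes>\<^bsub>K\<^esub> c False True = \<zero>\<^bsub>K\<^esub>"
    using vanish[of True True]
    by (simp add: sum_cosets v Q.nf_inv Q.nf_mult c_def coset_sum_def vc K.l_distr K.r_distr K.m_comm K.a_ac)
qed

text \<open>
  Modulo \<open>1 + z\<close> a unitary unit is a single group element: its four coset sums add up to its
  augmentation, so they form a unit vector.
\<close>

lemma unitary_coset_sum:
  assumes v: "v \<in> carrier KG" and vv: "v \<otimes>\<^bsub>KG\<^esub> star Q v = \<one>\<^bsub>KG\<^esub>"
    and aug: "augmentation K Q v = \<one>\<^bsub>K\<^esub>"
  obtains a b where "\<And>a' b'. coset_sum v a' b' = (if a' = a \<and> b' = b then \<one>\<^bsub>K\<^esub> else \<zero>\<^bsub>K\<^esub>)"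
proof -
  let ?c = "coset_sum v"
  have "?c False False \<oplus>\<^bsub>K\<^esub> ?c True False \<oplus>\<^bsub>K\<^esub> ?c False True \<oplus>\<^bsub>K\<^esub> ?c True True = \<one>\<^bsub>K\<^esub>"
    using aug v by (simp add: augmentation_def sum_cosets coset_sum_def)
  then have *: "(?c False False, ?c True False, ?c False True, ?c True True) \<in>
      {(\<one>\<^bsub>K\<^esub>, \<zero>\<^bsub>K\<^esub>, \<zero>\<^bsub>K\<^esub>, \<zero>\<^bsub>K\<^esub>), (\<zero>\<^bsub>K\<^esub>, \<one>\<^bsub>K\<^esub>, \<zero>\<^bsub>K\<^esub>, \<zero>\<^bsub>K\<^esub>),
       (\<zero>\<^bsub>K\<^esub>, \<zero>\<^bsub>K\<^esub>, \<one>\<^bsub>K\<^esub>, \<zero>\<^bsub>K\<^esub>), (\<zero>\<^bsub>K\<^esub>, \<zero>\<^bsub>K\<^esub>, \<zero>\<^bsub>K\<^esub>, \<one>\<^bsub>K\<^esub>)}"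
    using unitary_coset_relations[OF v vv] coset_sum_closed[OF v]
    by (intro K.char2_unit_vector[OF two_zero]) auto
  have "\<exists>a b. \<forall>a' b'. ?c a' b' = (if a' = a \<and> b' = b then \<one>\<^bsub>K\<^esub> else \<zero>\<^bsub>K\<^esub>)"
    using * by (simp add: all_bool_eq ex_bool_eq) blast
  then show ?thesis
    using that by blast
qed

text \<open>
  Take \<open>g\<close> in the only coset whose sum is not zero. Then \<open>v g\<inverse>\<close> and \<open>1\<close> have the same coset sums, which says that
  \<open>n = 1 + v g\<inverse>\<close> lies in the ideal.
\<close>

lemma unitary_is_unit_of:
  assumes "v \<in> carrier (unitary_unit_group K Q)"
  obtains n g where "n \<in> I" "g \<in> carrier Q" "v = unit_of n g"
proof -
  have v: "v \<in> carrier KG" and vv: "v \<otimes>\<^bsub>KG\<^esub> star Q v = \<one>\<^bsub>KG\<^esub>" and aug: "augmentation K Q v = \<one>\<^bsub>K\<^esub>"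
    using assms by (simp_all add: mem_unitary_unit_group_iff)
  obtain a b where ab: "\<And>a' b'. coset_sum v a' b' = (if a' = a \<and> b' = b then \<one>\<^bsub>K\<^esub> else \<zero>\<^bsub>K\<^esub>)"
    using unitary_coset_sum[OF v vv aug] by blast
  define g where "g = Q.nf (a, b, False)"
  have g: "g \<in> carrier Q"
    by (simp add: g_def)
  define n where "n = \<one>\<^bsub>KG\<^esub> \<oplus>\<^bsub>KG\<^esub> v \<otimes>\<^bsub>KG\<^esub> basis (inv\<^bsub>Q\<^esub> g)"
  have n_closed: "n \<in> carrier KG"
    by (simp add: n_def v)
  have "n (Q.z \<otimes>\<^bsub>Q\<^esub> h) = n h" if h: "h \<in> carrier Q" for h
  proof -
    obtain a' b' c' where hg: "h \<otimes>\<^bsub>Q\<^esub> g = Q.nf (a', b', c')"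
      using h g by (meson Q.m_closed Q_cases)
    have zhg: "Q.z \<otimes>\<^bsub>Q\<^esub> h \<otimes>\<^bsub>Q\<^esub> g = Q.nf (a', b', \<not> c')"
      using h g by (simp add: Q.m_assoc hg Q.z_mult_nf)
    have "h = \<one>\<^bsub>Q\<^esub> \<longleftrightarrow> h \<otimes>\<^bsub>Q\<^esub> g = g"
      using h g by simp
    then have h1: "h = \<one>\<^bsub>Q\<^esub> \<longleftrightarrow> (a', b', c') = (a, b, False)"
      unfolding hg unfolding g_def nf_eq_iff .
    have "Q.z \<otimes>\<^bsub>Q\<^esub> h = \<one>\<^bsub>Q\<^esub> \<longleftrightarrow> Q.z \<otimes>\<^bsub>Q\<^esub> h \<otimes>\<^bsub>Q\<^esub> g = g"
      using h g by simp
    then have zh1: "Q.z \<otimes>\<^bsub>Q\<^esub> h = \<one>\<^bsub>Q\<^esub> \<longleftrightarrow> (a', b', \<not> c') = (a, b, False)"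
      unfolding zhg unfolding g_def nf_eq_iff .
    have nh: "n h = (if h = \<one>\<^bsub>Q\<^esub> then \<one>\<^bsub>K\<^esub> else \<zero>\<^bsub>K\<^esub>) \<oplus>\<^bsub>K\<^esub> v (Q.nf (a', b', c'))"
      using h g v by (simp add: n_def coeff_add coeff_one coeff_mult_basis hg)
    have nzh: "n (Q.z \<otimes>\<^bsub>Q\<^esub> h) = (if Q.z \<otimes>\<^bsub>Q\<^esub> h = \<one>\<^bsub>Q\<^esub> then \<one>\<^bsub>K\<^esub> else \<zero>\<^bsub>K\<^esub>) \<oplus>\<^bsub>K\<^esub> v (Q.nf (a', b', \<not> c'))"
      using h g v by (simp add: n_def coeff_add coeff_one coeff_mult_basis zhg)
    have vc: "v (Q.nf s) \<in> carrier K" for s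
      using v by simp
    have "v (Q.nf (a', b', c')) \<oplus>\<^bsub>K\<^esub> v (Q.nf (a', b', \<not> c')) = coset_sum v a' b'"
      using v by (cases c') (simp_all add: coset_sum_def K.a_comm)
    then have "n (Q.z \<otimes>\<^bsub>Q\<^esub> h) \<oplus>\<^bsub>K\<^esub> n h = \<zero>\<^bsub>K\<^esub>"
      unfolding nh nzh h1 zh1
      using ab[of a' b'] vc two_zero by (cases c') (auto simp: K.a_ac split: if_splits)
    then show ?thesis
      using add_eq_zero_iff n_closed h by simp
  qed
  then have "n \<in> I"
    using n_closed by (simp add: I_def)
  moreover have "v = unit_of n g"
  proof -
    have "\<one>\<^bsub>KG\<^esub> \<oplus>\<^bsub>KG\<^esub> n = v \<otimes>\<^bsub>KG\<^esub> basis (inv\<^bsub>Q\<^esub> g)"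
      using v by (simp add: n_def KG.a_assoc[symmetric] KG_add_self)
    then show ?thesis
      using v g by (simp add: unit_of_def KG.m_assoc basis_mult basis_one)
  qed
  ultimately show ?thesis
    using g that by blast
qed

section \<open>Splitting the unitary unit group\<close>

text \<open>
  A member of the ideal is determined by arbitrary values on the four cosets of \<open>{1, z}\<close>.
\<close>

lemma card_I: "card I = order K ^ 4"
proof -
  have inv_nf: "inv_into UNIV Q.nf (Q.nf s) = s" for s
    by (rule inv_into_f_f) (auto intro: injI simp: nf_eq_iff)
  let ?r = "\<lambda>n. \<lambda>(a, b)\<in>UNIV. n (Q.nf (a, b, False))"
  have "bij_betw ?r I ((UNIV :: (bool \<times> bool) set) \<rightarrow>\<^sub>E carrier K)"
  proof (rule bij_betw_imageI)
    show "inj_on ?r I"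
    proof (rule inj_onI)
      fix n m assume nm: "n \<in> I" "m \<in> I" and eq: "?r n = ?r m"
      have "n (Q.nf (a, b, False)) = m (Q.nf (a, b, False))" for a b
        using fun_cong[OF eq, of "(a, b)"] by simp
      then have "n (Q.nf (a, b, c)) = m (Q.nf (a, b, c))" for a b c
        using I_coeff[OF nm(1), of a b c False] I_coeff[OF nm(2), of a b c False] by simp
      then show "n = m"
        using nm by (intro element_eqI) (auto intro: I_closed elim: Q_cases)
    qed
    show "?r ` I = UNIV \<rightarrow>\<^sub>E carrier K"
    proof
      show "?r ` I \<subseteq> UNIV \<rightarrow>\<^sub>E carrier K"
        using I_closed by auto
      show "UNIV \<rightarrow>\<^sub>E carrier K \<subseteq> ?r ` I"
      proof
        fix d :: "bool \<times> bool \<Rightarrow> 'k" assume d: "d \<in> UNIV \<rightarrow>\<^sub>E carrier K"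
        let ?n = "\<lambda>g\<in>carrier Q. case inv_into UNIV Q.nf g of (a, b, c) \<Rightarrow> d (a, b)"
        have n: "?n (Q.nf (a, b, c)) = d (a, b)" for a b c
          by (simp add: inv_nf)
        have "?n (Q.z \<otimes>\<^bsub>Q\<^esub> h) = ?n h" if "h \<in> carrier Q" for h
          using that by (elim Q_cases) (simp only: Q.z_mult_nf n)
        moreover have "?n \<in> carrier KG"
          using PiE_mem[OF d UNIV_I] by (auto simp: mem_carrier_iff split: prod.split)
        ultimately have nI: "?n \<in> I"
          by (auto simp: I_def simp del: restrict_apply)
        have rn: "?r ?n = d"
        proof (rule ext)
          fix p :: "bool \<times> bool"
          show "?r ?n p = d p"
            using n by (cases p) (simp del: restrict_apply add: restrict_apply'[OF UNIV_I])
        qed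
        show "d \<in> ?r ` I"
          by (rule image_eqI[of d ?r ?n, OF rn[symmetric] nI])
      qed
    qed
  qed
  then have "card I = card ((UNIV :: (bool \<times> bool) set) \<rightarrow>\<^sub>E carrier K)"
    by (rule bij_betw_same_card)
  also have "\<dots> = order K ^ 4"
    by (simp add: card_PiE order_def card_cartesian_product flip: UNIV_Times_UNIV)
  finally show ?thesis .
qed

text \<open>
  The map \<open>(n, g) \<mapsto> (1 + n) g\<close> from the additive group of the ideal times \<open>Q\<close> is a surjective homomorphism
  with kernel \<open>{(0, 1), (1 + z, z)}\<close>. Restricting \<open>n\<close> to a complement \<open>M\<close> of \<open>{0, 1 + z}\<close> in the ideal removes
  the kernel and keeps the image. The ideal has order \<open>(2\<^sup>k)\<^sup>4\<close>, so \<open>M\<close> is elementary abelian of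
  order \<open>2\<^bsup>4k-1\<^esup>\<close>.
\<close>

theorem unitary_unit_group_iso:
  assumes k: "k \<ge> 1" and card_K: "order K = 2 ^ k"
  shows "unitary_unit_group K Q \<cong>
    product_group {..<4 * k - 1} (\<lambda>_. integer_mod_group 2) \<times>\<times> Q"
proof -
  define E where "E = \<lparr>carrier = I, monoid.mult = (\<oplus>\<^bsub>KG\<^esub>), one = \<zero>\<^bsub>KG\<^esub>\<rparr>"
  have E_simps: "carrier E = I" "\<one>\<^bsub>E\<^esub> = \<zero>\<^bsub>KG\<^esub>" "n \<otimes>\<^bsub>E\<^esub> m = n \<oplus>\<^bsub>KG\<^esub> m" for n m
    by (simp_all add: E_def)
  interpret E: group E
  proof (rule groupI)
    show "\<exists>m\<in>carrier E. m \<otimes>\<^bsub>E\<^esub> n = \<one>\<^bsub>E\<^esub>" if "n \<in> carrier E" for n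
      using that KG_add_self I_closed by (auto simp: E_simps)
  qed (auto simp: E_simps I_add I_zero I_closed KG.a_assoc)
  have order_E: "order E = 2 ^ (4 * k)"
    using card_I by (simp add: order_def E_simps card_K[unfolded order_def] power_mult[symmetric] mult.commute)
  then have fin: "finite (carrier E)"
    using E.order_gt_0_iff_finite by simp
  have inv2: "n \<otimes>\<^bsub>E\<^esub> n = \<one>\<^bsub>E\<^esub>" if "n \<in> carrier E" for n
    using that KG_add_self I_closed by (simp add: E_simps)
  obtain M where M: "subgroup M E" "z_offset \<notin> M"
      "\<And>n. n \<in> carrier E \<Longrightarrow> n \<notin> M \<Longrightarrow> z_offset \<otimes>\<^bsub>E\<^esub> n \<in> M"
    using E.complement_of_involution[OF fin inv2, of z_offset] z_offset_in_I z_offset_nonzero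
    by (auto simp: E_simps)
  interpret M: subgroup M E by (rule M)
  have MI: "n \<in> I" if "n \<in> M" for n
    using that M.subset by (auto simp: E_simps)
  have M_add: "n \<oplus>\<^bsub>KG\<^esub> m \<in> M" if "n \<in> M" "m \<in> M" for n m
    using that M.m_closed by (simp add: E_simps)
  have group_M: "group (E\<lparr>carrier := M\<rparr>)"
    by (rule M.subgroup_is_group[OF E.group_axioms])
  have "2 ^ (4 * k) = 2 * card M"
    using E.card_twice_complement[OF fin inv2 _ M] order_E z_offset_in_I by (simp add: E_simps)
  moreover have "(2::nat) ^ (4 * k) = 2 * 2 ^ (4 * k - 1)"
    using k by (simp add: power_Suc[symmetric] del: power_Suc)
  ultimately have "card M = 2 ^ (4 * k - 1)"
    by simp
  then have iso_M: "E\<lparr>carrier := M\<rparr> \<cong> product_group {..<4 * k - 1} (\<lambda>_. integer_mod_group 2)"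
    using inv2 M.subset
    by (intro elementary_abelian_2_group_iso[OF group_M]) (auto simp: order_def)
  let ?f = "\<lambda>(n, g). unit_of n g"
  have "?f \<in> iso (E\<lparr>carrier := M\<rparr> \<times>\<times> Q) (unitary_unit_group K Q)"
  proof (rule isoI)
    show "?f \<in> hom (E\<lparr>carrier := M\<rparr> \<times>\<times> Q) (unitary_unit_group K Q)"
      by (rule homI) (auto simp: MI unit_of_unitary mult_unitary_unit_group unit_of_mult E_simps)
    show "bij_betw ?f (carrier (E\<lparr>carrier := M\<rparr> \<times>\<times> Q)) (carrier (unitary_unit_group K Q))"
    proof (rule bij_betw_imageI)
      have "n = m \<and> g = h"
        if nm: "n \<in> M" "m \<in> M" and gh: "g \<in> carrier Q" "h \<in> carrier Q"
          and eq: "unit_of n g = unit_of m h" for n m g h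
      proof -
        have m: "m \<in> carrier KG" "n \<in> carrier KG"
          using nm MI I_closed by auto
        have "unit_of n g \<otimes>\<^bsub>KG\<^esub> unit_of m (inv\<^bsub>Q\<^esub> h) = unit_of m h \<otimes>\<^bsub>KG\<^esub> unit_of m (inv\<^bsub>Q\<^esub> h)"
          using eq by simp
        then have "unit_of (n \<oplus>\<^bsub>KG\<^esub> m) (g \<otimes>\<^bsub>Q\<^esub> inv\<^bsub>Q\<^esub> h) = \<one>\<^bsub>KG\<^esub>"
          using nm gh m by (simp add: unit_of_mult MI KG_add_self unit_of_zero_one)
        then have "n \<oplus>\<^bsub>KG\<^esub> m = \<zero>\<^bsub>KG\<^esub> \<and> g \<otimes>\<^bsub>Q\<^esub> inv\<^bsub>Q\<^esub> h = \<one>\<^bsub>Q\<^esub>"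
          using unit_of_eq_one[of "n \<oplus>\<^bsub>KG\<^esub> m" "g \<otimes>\<^bsub>Q\<^esub> inv\<^bsub>Q\<^esub> h"] M_add[OF nm] M(2) nm gh
          by (auto simp: MI I_add)
        moreover have "n = m" if "n \<oplus>\<^bsub>KG\<^esub> m = \<zero>\<^bsub>KG\<^esub>"
          using that KG_add_self[OF m(1)] KG.add.right_cancel[OF m(1) m(2) m(1)] by simp
        moreover have "g = h" if "g \<otimes>\<^bsub>Q\<^esub> inv\<^bsub>Q\<^esub> h = \<one>\<^bsub>Q\<^esub>"
          using that gh Q.inv_solve_right[of "\<one>\<^bsub>Q\<^esub>" g h] by simp
        ultimately show ?thesis
          by blast
      qed
      then show "inj_on ?f (carrier (E\<lparr>carrier := M\<rparr> \<times>\<times> Q))"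
        by (auto intro!: inj_onI)
      have "\<exists>n\<in>M. \<exists>g\<in>carrier Q. v = unit_of n g" if v: "v \<in> carrier (unitary_unit_group K Q)" for v
      proof -
        obtain n g where ng: "n \<in> I" "g \<in> carrier Q" "v = unit_of n g"
          using unitary_is_unit_of[OF v] by blast
        show ?thesis
        proof (cases "n \<in> M")
          case False
          \<comment> \<open>The other preimage of \<open>v\<close> has its first component in \<open>M\<close>.\<close>
          have "v = unit_of z_offset Q.z \<otimes>\<^bsub>KG\<^esub> unit_of n g"
            using ng by (simp add: unit_of_z_offset unit_of_closed)
          also have "\<dots> = unit_of (z_offset \<oplus>\<^bsub>KG\<^esub> n) (Q.z \<otimes>\<^bsub>Q\<^esub> g)"
            using ng by (simp add: unit_of_mult z_offset_in_I)
          finally have "v = unit_of (z_offset \<oplus>\<^bsub>KG\<^esub> n) (Q.z \<otimes>\<^bsub>Q\<^esub> g)" .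
          moreover have "z_offset \<oplus>\<^bsub>KG\<^esub> n \<in> M"
            using M(3)[of n] False ng by (simp add: E_simps)
          moreover have "Q.z \<otimes>\<^bsub>Q\<^esub> g \<in> carrier Q"
            using ng by simp
          ultimately show ?thesis
            by blast
        qed (use ng in blast)
      qed
      then show "?f ` carrier (E\<lparr>carrier := M\<rparr> \<times>\<times> Q) = carrier (unitary_unit_group K Q)"
        by (auto simp: MI unit_of_unitary image_iff)
    qed
  qed
  then have "E\<lparr>carrier := M\<rparr> \<times>\<times> Q \<cong> unitary_unit_group K Q"
    by (rule is_isoI)
  then have "unitary_unit_group K Q \<cong> E\<lparr>carrier := M\<rparr> \<times>\<times> Q"
    by (rule group.iso_sym[OF DirProd_group[OF group_M Q.group_axioms]])
  moreover have "E\<lparr>carrier := M\<rparr> \<times>\<times> Q \<cong>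
      product_group {..<4 * k - 1} (\<lambda>_. integer_mod_group 2) \<times>\<times> Q"
    by (rule group.DirProd_iso_trans[OF group_M iso_M iso_refl])
  ultimately show ?thesis
    by (rule iso_trans)
qed

end

theorem theorem2p3:
  fixes K :: "('k, 'm) ring_scheme" and k :: nat
  assumes "k \<ge> 1"
    and "field K"
    and "order K = 2 ^ k"
  shows "unitary_unit_group K Q8 \<cong>
           product_group {..<4 * k - 1} (\<lambda>_. integer_mod_group 2) \<times>\<times> Q8"
proof -
  interpret K: field K by fact
  interpret Q: quaternion_group Q8 "word_class Q8_relations [(Gen_x, True)]" "word_class Q8_relations [(Gen_y, True)]"
    by (rule quaternion_group_Q8)
  interpret quaternion_group_algebra K Q8 "word_class Q8_relations [(Gen_x, True)]" "word_class Q8_relations [(Gen_y, True)]"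
    by unfold_locales (rule K.two_eq_zero[OF assms(3)])
  show ?thesis
    using assms(1,3) by (rule unitary_unit_group_iso)
qed

end
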